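(* Let $p\in(0,1)$ and $\alpha\in(0,1)$ be fixed, let $q=1-p$, let $z_{\alpha}$ be the upper $\alpha$ quantile of the standard normal distribution, and let $X\sim \mathrm{Bin}(n,p)$. Let $p_U$ be the one-sided $1-\alpha$ Clopper--Pearson upper bound based on $X$ and let $L_{U,CP}=p_U-p$. Then, as $n\to\infty$, $$E(L_{U,CP})=n^{-1/2}z_\alpha(pq)^{1/2}+(3n)^{-1}\Big(2(1/2-p)z_{\alpha}^2+1+q\Big)+n^{-3/2}z_{\alpha}(pq)^{1/2}\Big(-\frac{53}{36}+\frac{\frac{1}{2}-p}{q}+\frac{z_{\alpha}^2+\frac{13}{2}}{36pq}-\frac{13z_{\alpha}^2}{36}\Big)+O(n^{-2}).$$
   Context: The one-sided $1-\alpha$ Clopper--Pearson upper bound $p_U$ for a binomial proportion based on an observation $X\in\{0,1,\dots,n-1\}$ from $n$ trials is the solution $p_U\in(0,1)$ of $\sum_{k=0}^{X}\binom{n}{k}p_U^k(1-p_U)^{n-k}=\alpha$; equivalently $p_U=B(1-\alpha,X+1,n-X)$, where $B(\gamma,a,b)$ is the $\gamma$-quantile of the $Beta(a,b)$ distribution. For $X=n$ set $p_U=1$. *)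

theory Defs
  imports "HOL-Probability.Probability" "HOL-Library.Landau_Symbols"
begin

text \<open>The upper \<open>\<alpha>\<close> quantile is the point with mass \<open>\<alpha>\<close> to its right, i.e. the
  \<open>1 - \<alpha>\<close> quantile; it exists and is unique for \<open>0 < \<alpha> < 1\<close>.\<close>

definition std_normal_upper_quantile :: "real \<Rightarrow> real" where
  "std_normal_upper_quantile \<alpha> =
     (THE z. measure std_normal_distribution {z<..} = \<alpha>)"

text \<open>One-sided \<open>1 - \<alpha>\<close> Clopper--Pearson upper bound for \<open>X\<close> successes in \<open>n\<close> trials.
  For \<open>X < n\<close> and \<open>0 < \<alpha> < 1\<close> the defining equation has exactly one solution in \<open>(0,1)\<close>,
  since its left-hand side is continuous and strictly decreasing from 1 to 0.\<close>

definition cp_upper :: "nat \<Rightarrow> real \<Rightarrow> nat \<Rightarrow> real" where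
  "cp_upper n \<alpha> X =
     (if X < n
      then (THE u. 0 < u \<and> u < 1 \<and>
              (\<Sum>k=0..X. real (n choose k) * u ^ k * (1 - u) ^ (n - k)) = \<alpha>)
      else 1)"

definition cp_upper_length :: "nat \<Rightarrow> real \<Rightarrow> real \<Rightarrow> nat \<Rightarrow> real" where
  "cp_upper_length n \<alpha> p X = cp_upper n \<alpha> X - p"

end

theory Submission
  imports Defs "HOL-Real_Asymp.Real_Asymp"
begin

text \<open>Write \<open>e = n\<^sup>-\<^sup>1\<^sup>/\<^sup>2\<close>, \<open>x/n\<close> for the observed proportion and \<open>G(u)\<close> for the binomial distribution
  function at \<open>x\<close> as a function of the success probability, so that \<open>1 - G\<close> is the distribution function
  of a Beta law and \<open>p\<^sub>U\<close> is the solution of \<open>G(u) = \<alpha>\<close>. Let \<open>U(z)\<close> be the third order Cornish--Fisher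
  polynomial for this Beta law. Its coefficients are such that the derivative of \<open>1 - G(U(z))\<close> equals
  \<open>C \<phi>(z) (1 + O(e\<^sup>3 (1 + |z|)\<^sup>5))\<close> for \<open>e z\<^sup>2 \<le> 1\<close>, with a factor \<open>C\<close> independent of \<open>z\<close>. Comparing the
  total masses (Hoeffding's inequality controls the tails) forces \<open>C = 1 + O(e\<^sup>3)\<close>, so that Stirling's formula is
  not needed, and \<open>1 - G(U(z)) = \<Phi>(z) + O(e\<^sup>3)\<close> follows. Inverting, \<open>p\<^sub>U = U(z\<^sub>\<alpha>) + O(e\<^sup>4)\<close> uniformly for
  \<open>x/n\<close> in a compact subset of \<open>(0,1)\<close>. Finally \<open>U(z\<^sub>\<alpha>)\<close> is expanded around \<open>x/n = p\<close> to second order; the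
  error is bounded by \<open>e\<^sup>4 + e\<^sup>2 (x/n - p)\<^sup>2 + (x/n - p)\<^sup>4\<close>, whose expectation is \<open>O(n\<^sup>-\<^sup>2)\<close>.\<close>

section \<open>The Cornish--Fisher coefficients and their cancellations\<close>

text \<open>The range \<open>e * z^2 \<le> 1\<close> shapes the estimates. On it the shift
  \<open>cf e p z - z\<close> is O(1) and the error \<open>e^3 * (1 + |z|)^5\<close> in the exponent
  stays bounded, so exponentiating it costs only a constant factor. Its edge Z = e^(-1/2) is still
  remote enough: the sixth moment bounds the normal tail by 15 / Z^6 = 15 e^3, and Hoeffding's
  inequality bounds the binomial tails by exp (-c / e). The power 5 arises because the logarithms
  are expanded to fourth order and their error, of order (e (1 + |z|))^5, is multiplied by n =
  e^(-2). All this must be uniform in the centre x / n, since x is random; the true p enters only at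
  the end. There d = x / n - p counts as being of the same size as e, and terms of total degree at
  most 3 are kept. In the expectation, the curvature of sqrt (x (1 - x)) at p contributes -z / (8 s)
  with s = sqrt (p q), which turns the 11 of \<open>cf2\<close> into the 13/2 of the
  statement.\<close>

text \<open>The polynomials \<open>cf1\<close> and \<open>cf2\<close> are determined by \<open>cf_order1\<close> and \<open>cf_order2\<close> below: in the
  expansion of the logarithm of the density of the transformed Beta law in powers of \<open>e\<close>, the terms of orders
  \<open>e\<close> and \<open>e\<^sup>2\<close> must not depend on \<open>z\<close>.\<close>

definition cf1 :: "real \<Rightarrow> real \<Rightarrow> real" where
  "cf1 p z = ((1 - 2*p) * z^2 + 2 - p) / (3 * sqrt (p * (1 - p)))"

definition cf2 :: "real \<Rightarrow> real \<Rightarrow> real" where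
  "cf2 p z = z * (z^2 + 11 + 18 * p * (1 - 2*p)) / (36 * (p * (1 - p))) - z * (53 + 13 * z^2) / 36"

definition cf :: "real \<Rightarrow> real \<Rightarrow> real \<Rightarrow> real" where
  "cf e p z = z + e * cf1 p z + e^2 * cf2 p z"

definition cp_approx :: "real \<Rightarrow> real \<Rightarrow> real \<Rightarrow> real" where
  "cp_approx e p z = p + e * sqrt (p * (1 - p)) * cf e p z"

definition cf1' :: "real \<Rightarrow> real \<Rightarrow> real" where
  "cf1' p z = 2 * (1 - 2*p) * z / (3 * sqrt (p * (1 - p)))"

definition cf2' :: "real \<Rightarrow> real \<Rightarrow> real" where
  "cf2' p z = (3 * z^2 + 11 + 18 * p * (1 - 2*p)) / (36 * (p * (1 - p))) - (53 + 39 * z^2) / 36"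

definition cf' :: "real \<Rightarrow> real \<Rightarrow> real \<Rightarrow> real" where
  "cf' e p z = 1 + e * cf1' p z + e^2 * cf2' p z"

lemma DERIV_cf1: "(cf1 p has_real_derivative cf1' p z) (at z)"
  unfolding cf1_def[abs_def] cf1'_def
  by (rule DERIV_cdivide) (auto intro!: derivative_eq_intros)

lemma DERIV_cf2: "(cf2 p has_real_derivative cf2' p z) (at z)"
  unfolding cf2_def[abs_def] cf2'_def
  by (intro DERIV_diff DERIV_cdivide)
     (auto intro!: derivative_eq_intros simp: algebra_simps power2_eq_square)

lemma DERIV_cf: "(cf e p has_real_derivative cf' e p z) (at z)"
  unfolding cf_def[abs_def] cf'_def
  by (auto intro!: derivative_eq_intros DERIV_cf1 DERIV_cf2)

lemma DERIV_cp_approx: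
  "(cp_approx e p has_real_derivative e * sqrt (p * (1 - p)) * cf' e p z) (at z)"
  unfolding cp_approx_def[abs_def]
  by (auto intro!: derivative_eq_intros DERIV_cf)

text \<open>The \<open>e^2\<close> coefficient in \<open>cf_order2\<close> evaluated at z = 0, where
  \<open>cf1'\<close> and all explicit powers of z vanish. Depending on p only, it can be moved into
  the normalizing factor.\<close>

definition cf_const :: "real \<Rightarrow> real" where
  "cf_const p = (let s = sqrt (p * (1 - p)) in
     p / s * cf1 p 0 - (cf1 p 0)^2 / 2 + cf2' p 0)"

text \<open>\<open>- z * cf1 p z\<close> comes from shifting \<open>- y^2 / 2\<close>, the two
  fractions from the log likelihood, and \<open>cf1'\<close> from the logarithm of the Jacobian.
  Every term is odd in z, so a value independent of z can only be 0.\<close>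

lemma cf_order1:
  assumes "0 < p" "p < 1" defines "s \<equiv> sqrt (p * (1 - p))"
  shows "- z * cf1 p z + (1 - 2*p) / (3 * s) * z^3 + p / s * z + cf1' p z = 0"
  using assms unfolding cf1_def cf1'_def by (simp add: field_simps power2_eq_square power3_eq_cube)

lemma cf_order2:
  assumes "0 < p" "p < 1" defines "s \<equiv> sqrt (p * (1 - p))"
  shows "- ((cf1 p z)^2 / 2 + z * cf2 p z) + 3 * ((1 - 2*p) / (3 * s)) * z^2 * cf1 p z
     - (1 - 3 * s^2) / (4 * s^2) * z^4 + p / s * cf1 p z + p^2 / (2 * s^2) * z^2 + cf2' p z
     - (cf1' p z)^2 / 2 - cf_const p = 0"
proof -
  have s: "s > 0" "s^2 = p * (1-p)" using assms by (auto simp: s_def)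
  have n: "p \<noteq> 0" "1 - p \<noteq> 0" using assms by auto
  \<comment> \<open>After inserting \<open>cf1\<close> and \<open>cf1'\<close> only even powers of
    \<open>s\<close> remain, so with t = s^2 the claim becomes a rational identity.\<close>
  define t where "t = p * (1-p)"
  have t: "t \<noteq> 0" using n by (simp add: t_def)
  have s2: "s * s = t" using s by (simp add: power2_eq_square t_def)
  define c where "c = (1 - 2*p) * z^2 + 2 - p"
  have 1: "cf1 p z = c / (3 * s)" by (simp add: cf1_def s_def c_def)
  have 2: "cf1' p z = 2 * (1 - 2*p) * z / (3 * s)" by (simp add: cf1'_def s_def)
  have 3: "cf_const p = p * (2-p)/ (3*t) - (2-p)^2 / (18*t) + (11 + 18 * p * (1 - 2*p)) / (36*t) - 53 / 36"
  proof -
    have "p / s * cf1 p 0 = p * (2 - p) / (3 * t)" "(cf1 p 0)^2 = (2-p)^2 / (9 * t)"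
      using s2 by (simp_all add: cf1_def s_def[symmetric] power2_eq_square mult.assoc mult.left_commute)
    thus ?thesis
      unfolding cf_const_def Let_def s_def[symmetric] unfolding cf2'_def t_def[symmetric] by simp
  qed
  have e1: "(cf1 p z)^2 = c^2 / (9*t)" "(cf1' p z)^2 = 4 * (1 - 2*p)^2 * z^2 / (9*t)"
    using s2 unfolding 1 2 by (simp_all add: power2_eq_square) (simp add: algebra_simps)
  have e2: "3 * ((1 - 2*p) / (3 * s)) * z^2 * cf1 p z = (1 - 2*p) * z^2 * c / (3 * t)"
           "p / s * cf1 p z = p * c / (3*t)" "s^2 = t"
  proof -
    have "3 * (r / (3 * s)) * y * (c / (3 * s)) = r * y * c / (3 * (s * s))" for r y by simp
    thus "3 * ((1 - 2*p) / (3 * s)) * z^2 * cf1 p z = (1 - 2*p) * z^2 * c / (3 * t)"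
      unfolding 1 s2 .
    have "p / s * (c / (3 * s)) = p * c / (3 * (s * s))" by simp
    thus "p / s * cf1 p z = p * c / (3*t)" unfolding 1 s2 .
    show "s^2 = t" using s2 by (simp add: power2_eq_square)
  qed
  show ?thesis unfolding e1 e2 3 unfolding cf2_def cf2'_def t_def[symmetric]
    using t by (simp add: field_simps c_def) (simp add: t_def; algebra)
qed

text \<open>Exact, not asymptotic: with y = z + e m, the orders e and e^2 vanish by
  \<open>cf_order1\<close> and \<open>cf_order2\<close>. The rest is kept factored in m and y, as in
  y^4 - z^4 = (y - z) (y + z) (y^2 + z^2), so that its degree in z can be read off factor by
  factor.\<close>

lemma cf_remainder_identity:
  fixes e p z :: real
  assumes p: "0 < p" "p < 1"
  defines "s \<equiv> sqrt (p * (1 - p))"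
  defines "a \<equiv> cf1 p z" and "b \<equiv> cf2 p z" and "a' \<equiv> cf1' p z" and "b' \<equiv> cf2' p z"
  defines "y \<equiv> cf e p z" and "A \<equiv> (1 - 2*p) / (3 * s)" and "B \<equiv> (1 - 3 * s^2) / (4 * s^2)"
  defines "v \<equiv> e * a' + e^2 * b'" and "m \<equiv> a + e * b"
  shows "- (y^2) / 2 + e * A * y^3 - e^2 * B * y^4 + e * (p/s) * y + e^2 * (p^2 / (2 * s^2)) * y^2
           + v - v^2/2 + z^2/2 - cf_const p * e^2 =
         e^3 * (- b * (a + m) / 2 + A * (3 * z^2 * b + 3 * z * m^2 + (e * m) * m^2)
           - B * m * (z + y) * (z^2 + y^2) + p/s * b + p^2 / (2 * s^2) * m * (y + z)
           - b' * (2 * a' + e * b') / 2)"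
proof -
  have o1: "- z * a + A * z^3 + p / s * z + a' = 0"
    using cf_order1[OF p, of z] by (simp add: a_def A_def a'_def s_def)
  have o2: "- (a^2 / 2 + z * b) + 3 * A * z^2 * a - B * z^4 + p / s * a + p^2 / (2 * s^2) * z^2 + b'
     - a'^2 / 2 - cf_const p = 0"
    using cf_order2[OF p, of z] unfolding a_def A_def a'_def s_def B_def b_def b'_def by simp
  define g h where "g = p/s" and "h = p^2 / (2 * s^2)"
  have y: "y = z + e * m" by (simp add: y_def cf_def m_def a_def b_def algebra_simps power2_eq_square)
  have "a' = z * a - A * z^3 - g * z" using o1 by (simp add: g_def)
  moreover have "cf_const p = - (a^2 / 2 + z * b) + 3 * A * z^2 * a - B * z^4 + g * a + h * z^2 + b'
     - a'^2 / 2" using o2 by (simp add: g_def h_def)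
  ultimately show ?thesis unfolding g_def[symmetric] h_def[symmetric] y v_def m_def
    by (simp add: field_simps) algebra
qed

text \<open>The linear terms of the two \<open>T\<close> cancel. The subtracted quadratic belongs to
  the exponent n - x - 1 in place of n - x; as it is not divided by e^2, two orders fewer suffice.
  The coefficients p / s arise from s / (1 - p) = p / s.\<close>

lemma log_likelihood_polynomial:
  fixes e p y :: real
  assumes p: "0 < p" "p < 1" and e: "e \<noteq> 0"
  defines "s \<equiv> sqrt (p * (1 - p))"
  defines "d \<equiv> e * s * y"
  defines "T \<equiv> \<lambda>y. y - (y^2) / 2 + y^3/3 - y^4/4"
  shows "(p * T (d/p) + (1-p) * T (-d/(1-p))) / e^2 - (- d/(1-p) - (-d/(1-p))^2/2)
    = - (y^2) / 2 + e * ((1 - 2*p) / (3 * s)) * y^3 - e^2 * ((1 - 3 * s^2) / (4 * s^2)) * y^4 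
       + e * (p/s) * y + e^2 * (p^2 / (2 * s^2)) * y^2"
proof -
  have s: "s > 0" "s^2 = p * (1-p)" using p by (auto simp: s_def)
  define q where "q = 1 - p"
  have q: "q > 0" "p = 1 - q" using p by (auto simp: q_def)
  have s2: "s^2 = p * q" using s by (simp add: q_def)
  have s3: "s^3 = p * q * s" "s^4 = p^2 * q^2"
  proof -
    have "s^3 = s^2 * s" "s^4 = (s^2)^2" by algebra+
    thus "s^3 = p * q * s" "s^4 = p^2 * q^2" by (simp_all add: s2 power_mult_distrib)
  qed
  have T: "(p * T (d/p) + q * T (-d/q)) = - (d^2 * (1/p + 1/q))/2 + d^3 * (1/p^2 - 1/q^2)/3 - d^4 * (1/p^3 + 1/q^3)/4"
    using p q(1) unfolding T_def by (simp add: power2_eq_square power3_eq_cube power4_eq_xxxx field_simps)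
  have 1: "s^2 * (1/p + 1/q) = 1" using p q by (simp add: s2 field_simps)
  have 2: "s^3 * (1/p^2 - 1/q^2) = (1 - 2*p)/ s"
  proof -
    have "s^3 * (1/p^2 - 1/q^2) * s = 1 - 2*p"
    proof -
      have "s^3 * (1/p^2 - 1/q^2) * s = s^4 * (1/p^2 - 1/q^2)" by (simp add: power4_eq_xxxx power3_eq_cube)
      also have "\<dots> = q^2 - p^2" using p q(1) by (simp add: s3 field_simps)
      also have "\<dots> = 1 - 2*p" by (simp add: q_def power2_eq_square algebra_simps)
      finally show ?thesis .
    qed
    thus ?thesis using s by (simp add: field_simps)
  qed
  have 3: "s^4 * (1/p^3 + 1/q^3) = (1 - 3 * s^2)/s^2"
  proof -
    have "s^4 * (1/p^3 + 1/q^3) = (q^3 + p^3) / (p*q)" using p q(1) by (simp add: s3 field_simps power3_eq_cube power2_eq_square)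
    also have "q^3 + p^3 = 1 - 3 * (p*q)" unfolding q_def by algebra
    finally show ?thesis by (simp add: s2)
  qed
  have 4: "s / q = p / s" using s(1) s2 q(1) by (simp add: field_simps power2_eq_square)
  have 5: "(p * T (d/p) + q * T (-d/q)) = e^2 * (- (y^2) / 2 + e * y^3 * ((1 - 2*p)/s) / 3 - e^2 * y^4 * ((1 - 3 * s^2)/s^2) / 4)"
  proof -
    have "(p * T (d/p) + q * T (-d/q)) = - (e^2 * y^2 * (s^2 * (1/p + 1/q)))/2 + e^3 * y^3 * (s^3 * (1/p^2 - 1/q^2))/3 - e^4 * y^4 * (s^4 * (1/p^3 + 1/q^3))/4"
      unfolding T unfolding d_def power_mult_distrib by (simp only: mult_ac)
    also have "\<dots> = e^2 * (- (y^2) / 2 + e * y^3 * ((1 - 2*p)/s) / 3 - e^2 * y^4 * ((1 - 3 * s^2)/s^2) / 4)"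
      unfolding 1 2 3 by (simp add: algebra_simps power2_eq_square power3_eq_cube power4_eq_xxxx)
    finally show ?thesis .
  qed
  have 6: "d / q = e * y * (p / s)" by (simp add: d_def 4[symmetric])
  have "(p * T (d/p) + q * T (-d/q)) / e^2 - (- d/q - (-d/q)^2/2) = (- (y^2) / 2 + e * y^3 * ((1 - 2*p)/s) / 3 - e^2 * y^4 * ((1 - 3 * s^2)/s^2) / 4)
    + e * y * (p / s) + (e * y * (p / s))^2 / 2"
    unfolding 5 using e by (simp add: 6)
  also have "\<dots> = - (y^2) / 2 + e * ((1 - 2*p) / (3 * s)) * y^3 - e^2 * ((1 - 3 * s^2) / (4 * s^2)) * y^4 
       + e * (p/s) * y + e^2 * (p^2 / (2 * s^2)) * y^2"
    by (simp add: power_mult_distrib power_divide mult.commute mult.left_commute)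
  finally show ?thesis by (simp add: q_def)
qed

section \<open>Uniform expansion of the logarithm of the likelihood kernel\<close>

text \<open>\<open>real_asymp\<close> gives the estimate on a punctured neighbourhood. The functions
  substituted for y may vanish, so the point 0, where both sides are 0, has to be included.\<close>

lemma ln_remainder4: "(\<lambda>y::real. ln (1+y) - (y - y^2/2 + y^3/3 - y^4/4)) \<in> O[nhds 0](\<lambda>y. y^5)"
proof -
  have "(\<lambda>y::real. ln (1+y) - (y - y^2/2 + y^3/3 - y^4/4)) \<in> O[at 0](\<lambda>y. y^5)" by real_asymp
  then obtain c where c: "c > 0" "eventually (\<lambda>y::real. norm (ln (1+y) - (y - y^2/2 + y^3/3 - y^4/4)) \<le> c * norm (y^5)) (at 0)"
    by (rule landau_o.bigE)
  have "eventually (\<lambda>y::real. norm (ln (1+y) - (y - y^2/2 + y^3/3 - y^4/4)) \<le> c * norm (y^5)) (nhds 0)"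
    using c(2) unfolding eventually_at_filter by eventually_elim (auto)
  thus ?thesis by (rule landau_o.bigI[OF c(1)])
qed

lemma ln_remainder2: "(\<lambda>y::real. ln (1+y) - (y - y^2/2)) \<in> O[nhds 0](\<lambda>y. y^3)"
proof -
  have "(\<lambda>y::real. ln (1+y) - (y - y^2/2)) \<in> O[at 0](\<lambda>y. y^3)" by real_asymp
  then obtain c where c: "c > 0" "eventually (\<lambda>y::real. norm (ln (1+y) - (y - y^2/2)) \<le> c * norm (y^3)) (at 0)"
    by (rule landau_o.bigE)
  have "eventually (\<lambda>y::real. norm (ln (1+y) - (y - y^2/2)) \<le> c * norm (y^3)) (nhds 0)"
    using c(2) unfolding eventually_at_filter by eventually_elim (auto)
  thus ?thesis by (rule landau_o.bigI[OF c(1)])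
qed

text \<open>The index set \<open>'a\<close> will be the set of all triples \<open>(e, p, z)\<close> and \<open>F\<close> the filter that lets \<open>e\<close> tend to 0
  without restricting \<open>p\<close> and \<open>z\<close> further, so that Landau symbols along \<open>F\<close> are uniform in \<open>p\<close> and \<open>z\<close>.
  As \<open>e (1 + |z|)\<close> tends to 0, every factor \<open>e\<close> absorbs one factor \<open>1 + |z|\<close>.\<close>

locale cf_regime =
  fixes F :: "'a filter" and E P Z :: "'a \<Rightarrow> real" and \<eta> :: real
  assumes eta: "0 < \<eta>"
    and E_lim: "(E \<longlongrightarrow> 0) F"
    and E_pos: "eventually (\<lambda>x. 0 < E x) F"
    and P_range: "eventually (\<lambda>x. \<eta> \<le> P x \<and> P x \<le> 1 - \<eta>) F"
    and Z_range: "eventually (\<lambda>x. E x * (Z x)^2 \<le> 1) F"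
begin

definition W :: "'a \<Rightarrow> real" where "W x = 1 + \<bar>Z x\<bar>"

text \<open>Only the degree in \<open>1 + |z|\<close> is tracked; p enters through constants,
  uniformly, because it stays in [\<eta>, 1 - \<eta>].\<close>

definition growth_le :: "nat \<Rightarrow> ('a \<Rightarrow> real) \<Rightarrow> bool" where
  "growth_le k f \<longleftrightarrow> f \<in> O[F](\<lambda>x. W x ^ k)"

lemma W_ge_1: "1 \<le> W x" by (simp add: W_def)

lemma growth_le_le: "growth_le i f \<Longrightarrow> i \<le> k \<Longrightarrow> growth_le k f"
  unfolding growth_le_def
  by (erule landau_o.big.trans) (auto intro!: bigoI[where c=1] always_eventually power_increasing simp: W_ge_1 abs_of_nonneg order_trans[OF zero_le_one W_ge_1] power_abs)

lemma growth_le_mult: "growth_le i f \<Longrightarrow> growth_le j g \<Longrightarrow> growth_le (i + j) (\<lambda>x. f x * g x)"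
  unfolding growth_le_def power_add by (rule landau_o.big.mult)

lemma growth_le_power: "growth_le i f \<Longrightarrow> growth_le (i * n) (\<lambda>x. f x ^ n)"
  unfolding growth_le_def power_mult by (rule landau_o.big_power)

lemma growth_le_add: "growth_le i f \<Longrightarrow> growth_le j g \<Longrightarrow> growth_le (max i j) (\<lambda>x. f x + g x)"
  using growth_le_le[of i f "max i j"] growth_le_le[of j g "max i j"] unfolding growth_le_def by (auto intro: sum_in_bigo)

lemma growth_le_diff: "growth_le i f \<Longrightarrow> growth_le j g \<Longrightarrow> growth_le (max i j) (\<lambda>x. f x - g x)"
  using growth_le_le[of i f "max i j"] growth_le_le[of j g "max i j"] unfolding growth_le_def by (auto intro: sum_in_bigo)

lemma growth_le_uminus: "growth_le i f \<Longrightarrow> growth_le i (\<lambda>x. - f x)"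
  unfolding growth_le_def by simp

lemma growth_le_const: "growth_le 0 (\<lambda>x. c)"
  unfolding growth_le_def by simp

definition bounded_away :: "('a \<Rightarrow> real) \<Rightarrow> bool" where
  "bounded_away g \<longleftrightarrow> (\<exists>c>0. eventually (\<lambda>x. c \<le> \<bar>g x\<bar>) F)"

lemma bounded_away_const: "c \<noteq> 0 \<Longrightarrow> bounded_away (\<lambda>x. c)"
  unfolding bounded_away_def by (rule exI[of _ "\<bar>c\<bar>"]) auto

lemma bounded_away_mult:
  assumes "bounded_away f" "bounded_away g" shows "bounded_away (\<lambda>x. f x * g x)"
proof -
  obtain c d where c: "c > 0" "eventually (\<lambda>x. c \<le> \<bar>f x\<bar>) F" "d > 0" "eventually (\<lambda>x. d \<le> \<bar>g x\<bar>) F"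
    using assms unfolding bounded_away_def by blast
  have "eventually (\<lambda>x. c * d \<le> \<bar>f x * g x\<bar>) F"
    using c(2,4) by eventually_elim (use c in \<open>auto simp: abs_mult intro!: mult_mono\<close>)
  thus ?thesis using c unfolding bounded_away_def by (auto intro!: exI[of _ "c*d"])
qed

lemma bounded_away_power: "bounded_away f \<Longrightarrow> bounded_away (\<lambda>x. f x ^ n)"
  by (induction n) (auto intro: bounded_away_const bounded_away_mult)

lemma growth_le_divide:
  assumes "growth_le k f" "bounded_away g" shows "growth_le k (\<lambda>x. f x / g x)"
proof -
  obtain c where c: "c > 0" "eventually (\<lambda>x. c \<le> \<bar>g x\<bar>) F"
    using assms unfolding bounded_away_def by blast
  have "eventually (\<lambda>x. norm (inverse (g x)) \<le> inverse c * norm (1::real)) F"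
    using c(2) by eventually_elim (use c in \<open>auto simp: field_simps\<close>)
  hence "growth_le 0 (\<lambda>x. inverse (g x))"
    unfolding growth_le_def by (auto intro!: bigoI)
  from growth_le_mult[OF assms(1) this] show ?thesis by (simp add: divide_inverse)
qed

abbreviation S :: "'a \<Rightarrow> real" where "S x \<equiv> sqrt (P x * (1 - P x))"

lemma P_strict: "eventually (\<lambda>x. 0 < P x \<and> P x < 1) F"
  using P_range by eventually_elim (use eta in auto)

lemma growth_le_P: "growth_le 0 P"
  unfolding growth_le_def using P_strict by (auto intro!: bigoI[where c=1] elim!: eventually_mono)

lemma bounded_away_P: "bounded_away P"
  unfolding bounded_away_def using P_range eta by (intro exI[of _ \<eta>] conjI) (auto elim!: eventually_mono)

lemma bounded_away_Q: "bounded_away (\<lambda>x. 1 - P x)"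
  unfolding bounded_away_def using P_range eta by (intro exI[of _ \<eta>] conjI) (auto elim!: eventually_mono)

lemma bounded_away_S: "bounded_away S"
  unfolding bounded_away_def
proof (intro exI conjI)
  show "0 < \<eta>" by (fact eta)
  show "eventually (\<lambda>x. \<eta> \<le> \<bar>S x\<bar>) F"
    using P_range
  proof eventually_elim
    case (elim x)
    have "\<eta> * \<eta> \<le> P x * (1 - P x)" using elim eta by (intro mult_mono) auto
    hence "sqrt (\<eta> * \<eta>) \<le> S x" by (rule real_sqrt_le_mono)
    thus ?case using eta by simp
  qed
qed

lemma growth_le_S: "growth_le 0 S"
  unfolding growth_le_def
proof (rule bigoI[where c=1])
  show "eventually (\<lambda>x. norm (S x) \<le> 1 * norm (W x ^ 0)) F"
    using P_strict
  proof eventually_elim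
    case (elim x)
    have "P x * (1 - P x) \<le> 1 * 1" using elim by (intro mult_mono) auto
    thus ?case using elim by simp
  qed
qed

lemma growth_le_Z: "growth_le 1 Z"
  unfolding growth_le_def by (rule bigoI[where c=1]) (auto simp: W_def)

text \<open>E |Z| = sqrt E * sqrt (E Z^2) \<le> sqrt E on the range of the locale.\<close>

lemma EW_lim: "((\<lambda>x. E x * W x) \<longlongrightarrow> 0) F"
proof (rule tendsto_sandwich)
  show "eventually (\<lambda>x. 0 \<le> E x * W x) F"
    using E_pos by eventually_elim (auto simp: W_def)
  show "eventually (\<lambda>x. E x * W x \<le> E x + sqrt (E x)) F"
    using E_pos Z_range
  proof eventually_elim
    case (elim x)
    have "(E x * \<bar>Z x\<bar>)^2 = E x * (E x * (Z x)^2)" by (simp add: power2_eq_square mult_ac)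
    also have "\<dots> \<le> E x * 1" using elim by (intro mult_left_mono) auto
    finally have "E x * \<bar>Z x\<bar> \<le> sqrt (E x)" by (intro real_le_rsqrt) auto
    thus ?case by (simp add: W_def algebra_simps)
  qed
  show "((\<lambda>x. E x + sqrt (E x)) \<longlongrightarrow> 0) F"
    using tendsto_add[OF E_lim tendsto_real_sqrt[OF E_lim]] by simp
qed simp

lemma growth_le_E: "growth_le 0 E"
  unfolding growth_le_def
proof (rule bigoI[where c=1])
  have "eventually (\<lambda>x. E x < 1) F" using E_lim by (rule order_tendstoD) simp
  with E_pos show "eventually (\<lambda>x. norm (E x) \<le> 1 * norm (W x ^ 0)) F"
    by eventually_elim auto
qed

text \<open>One factor \<open>E\<close> cancels one factor \<open>W\<close>. The subtraction is
  truncated: for degree 0 the boundedness of \<open>E\<close> is what counts.\<close>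

lemma growth_le_E_mult: assumes "growth_le i f" shows "growth_le (i - 1) (\<lambda>x. E x * f x)"
proof (cases i)
  case 0
  with growth_le_mult[OF growth_le_E assms] show ?thesis by simp
next
  case (Suc j)
  have "(\<lambda>x. E x * W x) \<in> O[F](\<lambda>x. 1)"
    using EW_lim by (intro bigoI_tendsto[where c=0]) auto
  hence "(\<lambda>x. (E x * W x) * (W x ^ j)) \<in> O[F](\<lambda>x. 1 * (W x ^ j))"
    by (rule landau_o.big.mult) simp
  moreover have "(\<lambda>x. E x * f x) \<in> O[F](\<lambda>x. E x * W x ^ i)"
    using assms unfolding growth_le_def by (rule landau_o.big.mult_left)
  moreover have "(\<lambda>x. (E x * W x) * W x ^ j) = (\<lambda>x. E x * W x ^ i)"
    by (simp add: Suc mult_ac)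
  ultimately have "(\<lambda>x. E x * f x) \<in> O[F](\<lambda>x. 1 * W x ^ j)"
    by (metis landau_o.big.trans)
  thus ?thesis by (simp add: growth_le_def Suc)
qed

lemmas bounded_away_intros = bounded_away_const[OF numeral_neq_zero] bounded_away_P bounded_away_Q bounded_away_S bounded_away_mult bounded_away_power
text \<open>Used with \<open>growth_le_le\<close>, which leaves the degree schematic: the rules
  compute it and a final \<open>simp\<close> compares it with the claim.
  \<open>growth_le_E_mult\<close> stands before \<open>growth_le_mult\<close>, so that a left factor
  \<open>E\<close> lowers the degree.\<close>

lemmas growth_le_intros = growth_le_const growth_le_P growth_le_S growth_le_Z growth_le_E growth_le_E_mult growth_le_divide growth_le_add growth_le_diff growth_le_uminus growth_le_power growth_le_mult

lemma growth_le_cf1: "growth_le 2 (\<lambda>x. cf1 (P x) (Z x))"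
  unfolding cf1_def by (rule growth_le_le, (rule growth_le_intros bounded_away_intros)+, simp)

lemma growth_le_cf2: "growth_le 3 (\<lambda>x. cf2 (P x) (Z x))"
  unfolding cf2_def by (rule growth_le_le, (rule growth_le_intros bounded_away_intros)+, simp)

lemma growth_le_cf1': "growth_le 1 (\<lambda>x. cf1' (P x) (Z x))"
  unfolding cf1'_def by (rule growth_le_le, (rule growth_le_intros bounded_away_intros)+, simp)

lemma growth_le_cf2': "growth_le 2 (\<lambda>x. cf2' (P x) (Z x))"
  unfolding cf2'_def by (rule growth_le_le, (rule growth_le_intros bounded_away_intros)+, simp)

section \<open>Orders of the shift \<open>M\<close>, the displacement \<open>D\<close> and the
  Jacobian term \<open>V\<close>\<close>

definition M :: "'a \<Rightarrow> real" where "M x = cf1 (P x) (Z x) + E x * cf2 (P x) (Z x)"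

definition Y :: "'a \<Rightarrow> real" where "Y x = cf (E x) (P x) (Z x)"

definition D :: "'a \<Rightarrow> real" where "D x = E x * S x * Y x"

definition V :: "'a \<Rightarrow> real" where "V x = E x * cf1' (P x) (Z x) + (E x)^2 * cf2' (P x) (Z x)"

lemma Y_eq: "Y x = Z x + E x * M x"
  by (simp add: Y_def cf_def M_def algebra_simps power2_eq_square)

lemma growth_le_M: "growth_le 2 M"
  unfolding M_def[abs_def] by (rule growth_le_le, (rule growth_le_cf1 growth_le_cf2 growth_le_intros)+, simp)

lemma growth_le_Y: "growth_le 1 Y"
  unfolding Y_eq[abs_def] by (rule growth_le_le, (rule growth_le_M growth_le_intros)+, simp)

lemma V_over_E: "growth_le 1 (\<lambda>x. cf1' (P x) (Z x) + E x * cf2' (P x) (Z x))"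
  by (rule growth_le_le, (rule growth_le_cf1' growth_le_cf2' growth_le_intros)+, simp)

lemma V_eq: "V x = E x * (cf1' (P x) (Z x) + E x * cf2' (P x) (Z x))"
  by (simp add: V_def algebra_simps power2_eq_square)

lemma growth_le_1_imp: assumes "growth_le 1 f" shows "(\<lambda>x. E x * f x) \<in> O[F](\<lambda>x. E x * W x)"
  using assms unfolding growth_le_def by (auto intro: landau_o.big.mult_left)

lemma EW_imp_lim: assumes "f \<in> O[F](\<lambda>x. E x * W x)" shows "(f \<longlongrightarrow> 0) F"
proof -
  have "(\<lambda>x. E x * W x) \<in> o[F](\<lambda>x. 1)" using EW_lim by (intro smalloI_tendsto) auto
  with assms have "f \<in> o[F](\<lambda>x. 1)" by (rule landau_o.big_small_trans)
  from smalloD_tendsto[OF this] show ?thesis by simp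
qed

lemma V_bigo: "V \<in> O[F](\<lambda>x. E x * W x)"
  unfolding V_eq[abs_def] by (rule growth_le_1_imp[OF V_over_E])

lemma DP_bigo: "(\<lambda>x. D x / P x) \<in> O[F](\<lambda>x. E x * W x)"
proof -
  have "growth_le 1 (\<lambda>x. S x * Y x / P x)"
    by (rule growth_le_le, (rule growth_le_Y bounded_away_intros growth_le_intros)+, simp)
  from growth_le_1_imp[OF this] show ?thesis by (simp add: D_def mult_ac)
qed

lemma DQ_bigo: "(\<lambda>x. - D x / (1 - P x)) \<in> O[F](\<lambda>x. E x * W x)"
proof -
  have "growth_le 1 (\<lambda>x. - (S x * Y x) / (1 - P x))"
    by (rule growth_le_le, (rule growth_le_Y bounded_away_intros growth_le_intros)+, simp)
  from growth_le_1_imp[OF this] show ?thesis by (simp add: D_def mult_ac)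
qed

lemma compose_bigo_power:
  assumes "r \<in> O[nhds 0](\<lambda>y::real. y ^ k)" "f \<in> O[F](\<lambda>x. E x * W x)"
  shows "(\<lambda>x. r (f x)) \<in> O[F](\<lambda>x. E x ^ k * W x ^ k)"
proof -
  have "(\<lambda>x. r (f x)) \<in> O[F](\<lambda>x. f x ^ k)"
    using landau_o.big.compose[OF assms(1), OF EW_imp_lim[OF assms(2)]] .
  moreover have "(\<lambda>x. f x ^ k) \<in> O[F](\<lambda>x. (E x * W x) ^ k)"
    by (rule landau_o.big_power[OF assms(2)])
  ultimately show ?thesis unfolding power_mult_distrib by (rule landau_o.big.trans)
qed

lemma compose_bigo_power3:
  assumes "r \<in> O[nhds 0](\<lambda>y::real. y ^ 3)" "f \<in> O[F](\<lambda>x. E x * W x)"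
  shows "(\<lambda>x. r (f x)) \<in> O[F](\<lambda>x. E x ^ 3 * W x ^ 5)"
proof -
  have "growth_le 5 (\<lambda>x. W x ^ 3)"
    by (rule growth_le_le[of 3]) (auto simp: growth_le_def)
  hence "(\<lambda>x. E x ^ 3 * W x ^ 3) \<in> O[F](\<lambda>x. E x ^ 3 * W x ^ 5)"
    unfolding growth_le_def by (rule landau_o.big.mult_left)
  with compose_bigo_power[OF assms] show ?thesis by (rule landau_o.big.trans)
qed

text \<open>Dividing by \<open>E^2\<close> reduces \<open>E^5\<close> to \<open>E^3\<close> but
  leaves \<open>W^5\<close>: this is the origin of the weight in the final remainder.\<close>

lemma compose_bigo_power5:
  assumes "r \<in> O[nhds 0](\<lambda>y::real. y ^ 5)" "f \<in> O[F](\<lambda>x. E x * W x)" "growth_le 0 g"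
  shows "(\<lambda>x. g x * r (f x) / (E x)^2) \<in> O[F](\<lambda>x. E x ^ 3 * W x ^ 5)"
proof -
  have "(\<lambda>x. g x * (r (f x) / (E x)^2)) \<in> O[F](\<lambda>x. 1 * ((E x ^ 5 * W x ^ 5) / (E x)^2))"
  proof (rule landau_o.big.mult)
    show "g \<in> O[F](\<lambda>x. 1)" using assms(3) by (simp add: growth_le_def)
    have "eventually (\<lambda>x. (E x)^2 \<noteq> 0) F" using E_pos by eventually_elim auto
    thus "(\<lambda>x. r (f x) / (E x)^2) \<in> O[F](\<lambda>x. (E x ^ 5 * W x ^ 5) / (E x)^2)"
      by (rule landau_o.big.divide_right[OF _ compose_bigo_power[OF assms(1,2)]])
  qed
  also have "(\<lambda>x. 1 * ((E x ^ 5 * W x ^ 5) / (E x)^2)) \<in> \<Theta>[F](\<lambda>x. E x ^ 3 * W x ^ 5)"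
  proof (intro bigthetaI_cong eventually_mono[OF E_pos])
    fix x assume "0 < E x"
    moreover have "E x ^ 5 * W x ^ 5 = E x ^ 3 * W x ^ 5 * (E x)^2" by algebra
    ultimately show "1 * ((E x ^ 5 * W x ^ 5) / (E x)^2) = E x ^ 3 * W x ^ 5"
      by (simp only: mult_1_left divide_eq_eq) auto
  qed
  finally show ?thesis by simp
qed

text \<open>Each logarithm is a Taylor polynomial plus a remainder of the required order. By the two
  exact identities the polynomials add up to \<open>E x ^ 3 * Q x\<close>, and the terms of
  \<open>Q\<close> have degree at most 5.\<close>

lemma log_density_bigo:
  "(\<lambda>x. (P x * ln (1 + D x / P x) + (1 - P x) * ln (1 - D x / (1 - P x))) / (E x)^2
     - ln (1 - D x / (1 - P x)) + ln (1 + V x) + (Z x)^2 / 2 - cf_const (P x) * (E x)^2)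
   \<in> O[F](\<lambda>x. E x ^ 3 * W x ^ 5)"
proof -
  let ?T4 = "\<lambda>y::real. y - y^2/2 + y^3/3 - y^4/4" and ?T2 = "\<lambda>y::real. y - y^2/2"
  let ?r4 = "\<lambda>y::real. ln (1+y) - ?T4 y" and ?r2 = "\<lambda>y::real. ln (1+y) - ?T2 y"
  let ?dp = "\<lambda>x. D x / P x" and ?dq = "\<lambda>x. - D x / (1 - P x)"
  let ?a = "\<lambda>x. cf1 (P x) (Z x)" and ?b = "\<lambda>x. cf2 (P x) (Z x)"
  let ?a' = "\<lambda>x. cf1' (P x) (Z x)" and ?b' = "\<lambda>x. cf2' (P x) (Z x)"
  let ?A = "\<lambda>x. (1 - 2 * P x) / (3 * S x)" and ?B = "\<lambda>x. (1 - 3 * (S x)^2) / (4 * (S x)^2)"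
  define Q where "Q = (\<lambda>x. - ?b x * (?a x + M x) / 2
      + ?A x * (3 * (Z x)^2 * ?b x + 3 * Z x * (M x)^2 + (E x * M x) * (M x)^2)
      - ?B x * M x * (Z x + Y x) * ((Z x)^2 + (Y x)^2) + P x / S x * ?b x
      + (P x)^2 / (2 * (S x)^2) * M x * (Y x + Z x) - ?b' x * (2 * ?a' x + E x * ?b' x) / 2)"
  have "growth_le 5 Q"
    unfolding Q_def
    by (rule growth_le_le, (rule growth_le_cf1 growth_le_cf2 growth_le_cf1' growth_le_cf2' growth_le_M growth_le_Y growth_le_intros bounded_away_intros)+, simp)
  hence Q: "(\<lambda>x. E x ^ 3 * Q x) \<in> O[F](\<lambda>x. E x ^ 3 * W x ^ 5)"
    unfolding growth_le_def by (rule landau_o.big.mult_left)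
  have OQ: "growth_le 0 (\<lambda>x. 1 - P x)"
    by (rule growth_le_le, (rule growth_le_intros)+, simp)
  have "(\<lambda>x. (P x * ?r4 (?dp x) / (E x)^2 + (1 - P x) * ?r4 (?dq x) / (E x)^2 - ?r2 (?dq x) + ?r2 (V x)) + E x ^ 3 * Q x)
      \<in> O[F](\<lambda>x. E x ^ 3 * W x ^ 5)"
    by (intro sum_in_bigo(1) sum_in_bigo(2) Q
        compose_bigo_power5[OF ln_remainder4 DP_bigo growth_le_P]
        compose_bigo_power5[OF ln_remainder4 DQ_bigo OQ]
        compose_bigo_power3[OF ln_remainder2 DQ_bigo]
        compose_bigo_power3[OF ln_remainder2 V_bigo])
  also have "?this \<longleftrightarrow> ?thesis"
  proof (intro landau_o.big.in_cong)
    show "eventually (\<lambda>x. (P x * ?r4 (?dp x) / (E x)^2 + (1 - P x) * ?r4 (?dq x) / (E x)^2 - ?r2 (?dq x) + ?r2 (V x)) + E x ^ 3 * Q x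
      = (P x * ln (1 + D x / P x) + (1 - P x) * ln (1 - D x / (1 - P x))) / (E x)^2
     - ln (1 - D x / (1 - P x)) + ln (1 + V x) + (Z x)^2 / 2 - cf_const (P x) * (E x)^2) F"
      using P_strict E_pos
    proof eventually_elim
      case (elim x)
      have p: "0 < P x" "P x < 1" and e: "E x \<noteq> 0" using elim by auto
      have 1: "(P x * ?T4 (?dp x) + (1 - P x) * ?T4 (?dq x)) / (E x)^2 - ?T2 (?dq x)
         = - ((Y x)^2) / 2 + E x * ?A x * (Y x)^3 - (E x)^2 * ?B x * (Y x)^4
            + E x * (P x / S x) * Y x + (E x)^2 * ((P x)^2 / (2 * (S x)^2)) * (Y x)^2"
        unfolding D_def by (rule log_likelihood_polynomial[OF p e, of "Y x"])
      have 2: "- ((Y x)^2) / 2 + E x * ?A x * (Y x)^3 - (E x)^2 * ?B x * (Y x)^4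
            + E x * (P x / S x) * Y x + (E x)^2 * ((P x)^2 / (2 * (S x)^2)) * (Y x)^2
            + ?T2 (V x) + (Z x)^2 / 2 - cf_const (P x) * (E x)^2 = E x ^ 3 * Q x"
        using cf_remainder_identity[OF p, of "E x" "Z x"]
        unfolding Q_def Y_def V_def M_def by (simp only: add_diff_eq)
      define X1 where "X1 = (P x * ln (1 + D x / P x) + (1 - P x) * ln (1 - D x / (1 - P x))) / (E x)^2"
      define X2 where "X2 = (P x * ?T4 (?dp x) + (1 - P x) * ?T4 (?dq x)) / (E x)^2"
      have 3: "1 + ?dq x = 1 - D x / (1 - P x)" by simp
      have 4: "P x * ?r4 (?dp x) / (E x)^2 + (1 - P x) * ?r4 (?dq x) / (E x)^2 = X1 - X2"
        unfolding X1_def X2_def 3 by (simp only: right_diff_distrib diff_divide_distrib add_divide_distrib)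
      show ?case unfolding 4 unfolding 3 X1_def[symmetric] using 1 2 unfolding X2_def[symmetric] by linarith
    qed
  qed
  finally show ?thesis .
qed

lemma cf_eventually:
  obtains K where "K > 0" "eventually (\<lambda>x. 
    0 < cp_approx (E x) (P x) (Z x) \<and> cp_approx (E x) (P x) (Z x) < 1 \<and>
    1/2 < cf' (E x) (P x) (Z x) \<and> cf' (E x) (P x) (Z x) < 2 \<and>
    \<bar>cf (E x) (P x) (Z x) - Z x\<bar> \<le> K \<and>
    \<bar>(P x * ln (1 + D x / P x) + (1 - P x) * ln (1 - D x / (1 - P x))) / (E x)^2
      - ln (1 - D x / (1 - P x)) + ln (1 + V x) + (Z x)^2 / 2 - cf_const (P x) * (E x)^2\<bar>
      \<le> K * (E x ^ 3 * W x ^ 5)) F"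
proof -
  obtain K1 where K1: "K1 > 0" "eventually (\<lambda>x. norm ((P x * ln (1 + D x / P x) + (1 - P x) * ln (1 - D x / (1 - P x))) / (E x)^2
      - ln (1 - D x / (1 - P x)) + ln (1 + V x) + (Z x)^2 / 2 - cf_const (P x) * (E x)^2)
      \<le> K1 * norm (E x ^ 3 * W x ^ 5)) F"
    using log_density_bigo by (rule landau_o.bigE)
  \<comment> \<open>The degree rules give only degree 1 here. Boundedness needs the full strength of
    E Z^2 \<le> 1, through E W^2 \<le> 2 E + 2 E Z^2 \<le> 4.\<close>
  have EM: "(\<lambda>x. E x * M x) \<in> O[F](\<lambda>x. 1)"
  proof -
    have "(\<lambda>x. E x * M x) \<in> O[F](\<lambda>x. E x * W x ^ 2)"
      using growth_le_M unfolding growth_le_def by (rule landau_o.big.mult_left)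
    also have "(\<lambda>x. E x * W x ^ 2) \<in> O[F](\<lambda>x. 1)"
    proof (rule bigoI[where c=4])
      have "eventually (\<lambda>x. E x < 1) F" using E_lim by (rule order_tendstoD) simp
      with E_pos Z_range show "eventually (\<lambda>x. norm (E x * W x ^ 2) \<le> 4 * norm (1::real)) F"
      proof eventually_elim
        case (elim x)
        have "W x ^ 2 \<le> 2 + 2 * (Z x)^2"
          using zero_le_power2[of "1 - \<bar>Z x\<bar>"] by (simp add: W_def power2_eq_square algebra_simps)
        hence "E x * W x ^ 2 \<le> E x * (2 + 2 * (Z x)^2)" using elim by (intro mult_left_mono) auto
        thus ?case using elim by (simp add: algebra_simps)
      qed
    qed
    finally show ?thesis .
  qed
  obtain K2 where K2: "K2 > 0" "eventually (\<lambda>x. norm (E x * M x) \<le> K2 * norm (1::real)) F"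
    using EM by (rule landau_o.bigE)
  have "eventually (\<lambda>x. V x < 1) F" "eventually (\<lambda>x. V x > -1/2) F"
       "eventually (\<lambda>x. D x / P x > -1/2) F" "eventually (\<lambda>x. - D x / (1 - P x) > -1/2) F"
    by (rule order_tendstoD[OF EW_imp_lim[OF V_bigo]] order_tendstoD[OF EW_imp_lim[OF DP_bigo]]
         order_tendstoD[OF EW_imp_lim[OF DQ_bigo]]; simp)+
  hence "eventually (\<lambda>x. 
    0 < cp_approx (E x) (P x) (Z x) \<and> cp_approx (E x) (P x) (Z x) < 1 \<and>
    1/2 < cf' (E x) (P x) (Z x) \<and> cf' (E x) (P x) (Z x) < 2 \<and>
    \<bar>cf (E x) (P x) (Z x) - Z x\<bar> \<le> max K1 K2 \<and>
    \<bar>(P x * ln (1 + D x / P x) + (1 - P x) * ln (1 - D x / (1 - P x))) / (E x)^2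
      - ln (1 - D x / (1 - P x)) + ln (1 + V x) + (Z x)^2 / 2 - cf_const (P x) * (E x)^2\<bar>
      \<le> max K1 K2 * (E x ^ 3 * W x ^ 5)) F"
    using K1(2) K2(2) P_strict E_pos
  proof eventually_elim
    case (elim x)
    have U: "cp_approx (E x) (P x) (Z x) = P x + D x"
      by (simp add: cp_approx_def D_def Y_def)
    have V: "cf' (E x) (P x) (Z x) = 1 + V x" by (simp add: cf'_def V_def)
    have "0 < P x * (1 + D x / P x)" using elim by (intro mult_pos_pos) auto
    hence 1: "0 < P x + D x" using elim by (simp add: distrib_left)
    have "0 < (1 - P x) * (1 + (- D x) / (1 - P x))" using elim by (intro mult_pos_pos) auto
    hence 2: "P x + D x < 1" using elim by (simp add: distrib_left)
    have 3: "cf (E x) (P x) (Z x) - Z x = E x * M x" using Y_eq[of x] by (simp add: Y_def)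
    have 4: "0 \<le> E x ^ 3 * W x ^ 5" using elim W_ge_1[of x] by simp
    have "K1 * (E x ^ 3 * W x ^ 5) \<le> max K1 K2 * (E x ^ 3 * W x ^ 5)"
      using 4 by (intro mult_right_mono) auto
    have 5: "y \<le> K1 * \<bar>E x ^ 3 * W x ^ 5\<bar> \<Longrightarrow> y \<le> max K1 K2 * (E x ^ 3 * W x ^ 5)" for y
      using 4 \<open>K1 * _ \<le> max K1 K2 * _\<close> by (simp add: abs_of_nonneg)
    show ?case unfolding U V 3 using 1 2 elim(1,2,6) by (intro conjI 5[OF elim(5)[unfolded real_norm_def]]) auto
  qed
  thus ?thesis using that[of "max K1 K2"] K1 by auto
qed

end

text \<open>With 1 / e^2 = n and p = x / n this is the logarithm of the Beta kernel u^x (1 - u)^(n -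
  x - 1) relative to its value at u = p; the last term accounts for the -1 in the exponent.\<close>

definition log_density :: "real \<Rightarrow> real \<Rightarrow> real \<Rightarrow> real" where
  "log_density e p u = (p * ln (u / p) + (1 - p) * ln ((1 - u) / (1 - p))) / e^2 - ln ((1 - u) / (1 - p))"

text \<open>Estimates along a filter on triples are uniform estimates: unfolding
  \<open>eventually\<close> for the pullback of \<open>at_right 0\<close> along \<open>fst\<close>
  yields one threshold for e that serves all admissible p and z.\<close>

lemma cf_uniform:
  assumes "0 < \<eta>"
  obtains K e0 :: real where "0 < e0" "0 < K"
    "\<And>e p z. 0 < e \<Longrightarrow> e < e0 \<Longrightarrow> \<eta> \<le> p \<Longrightarrow> p \<le> 1 - \<eta> \<Longrightarrow> e * z^2 \<le> 1 \<Longrightarrow>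
      0 < cp_approx e p z \<and> cp_approx e p z < 1 \<and> 1/2 < cf' e p z \<and> cf' e p z < 2 \<and>
      \<bar>cf e p z - z\<bar> \<le> K \<and>
      \<bar>log_density e p (cp_approx e p z) + ln (cf' e p z) + z^2 / 2 - cf_const p * e^2\<bar>
        \<le> K * (e^3 * (1 + \<bar>z\<bar>)^5)"
proof -
  define A :: "(real \<times> real \<times> real) set" where
    "A = {x. \<eta> \<le> fst (snd x) \<and> fst (snd x) \<le> 1 - \<eta> \<and> fst x * (snd (snd x))^2 \<le> 1}"
  define F where "F = inf (filtercomap fst (at_right (0::real))) (principal A)"
  have ev: "eventually Q F \<longleftrightarrow> (\<exists>b>0. \<forall>e p z. 0 < e \<and> e < b \<and> (e, p, z) \<in> A \<longrightarrow> Q (e, p, z))" for Q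
    unfolding F_def eventually_inf_principal eventually_filtercomap eventually_at_right_field
  proof safe
    fix R b assume "\<forall>x. R (fst x) \<longrightarrow> x \<in> A \<longrightarrow> Q x" "0 < b" "\<forall>y>0. y < b \<longrightarrow> R y"
    thus "\<exists>b>0. \<forall>e p z. 0 < e \<and> e < b \<and> (e, p, z) \<in> A \<longrightarrow> Q (e, p, z)"
      by (intro exI[of _ b]) auto
  next
    fix b :: real assume "0 < b" "\<forall>e p z. 0 < e \<and> e < b \<and> (e, p, z) \<in> A \<longrightarrow> Q (e, p, z)"
    thus "\<exists>R. (\<exists>b>0. \<forall>y>0. y < b \<longrightarrow> R y) \<and> (\<forall>x. R (fst x) \<longrightarrow> x \<in> A \<longrightarrow> Q x)"
      by (intro exI[of _ "\<lambda>y. 0 < y \<and> y < b"]) auto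
  qed
  have lim: "(fst \<longlongrightarrow> 0) F"
    unfolding tendsto_iff ev by (auto intro!: exI)
  interpret cf_regime F fst "\<lambda>x. fst (snd x)" "\<lambda>x. snd (snd x)" \<eta>
    by unfold_locales (use assms lim in \<open>auto simp: ev A_def intro!: exI[of _ 1]\<close>)
  show thesis
  proof (rule cf_eventually, goal_cases)
    case (1 K)
    from 1(2) obtain b where b: "b > 0" and
      H: "\<And>e p z. 0 < e \<and> e < b \<and> (e, p, z) \<in> A \<Longrightarrow> 
       0 < cp_approx e p z \<and> cp_approx e p z < 1 \<and> 1/2 < cf' e p z \<and> cf' e p z < 2 \<and>
      \<bar>cf e p z - z\<bar> \<le> K \<and>
      \<bar>(p * ln (1 + D (e,p,z) / p) + (1 - p) * ln (1 - D (e,p,z) / (1 - p))) / e^2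
      - ln (1 - D (e,p,z) / (1 - p)) + ln (1 + V (e,p,z)) + z^2 / 2 - cf_const p * e^2\<bar>
        \<le> K * (e^3 * (1 + \<bar>z\<bar>)^5)"
      unfolding ev W_def by auto
    show ?case
    proof (rule that[of b K])
      fix e p z :: real assume *: "0 < e" "e < b" "\<eta> \<le> p" "p \<le> 1 - \<eta>" "e * z^2 \<le> 1"
      have p: "0 < p" "p < 1" using * assms by auto
      have U: "cp_approx e p z = p + D (e,p,z)"
        by (simp add: cp_approx_def D_def Y_def)
      have V: "cf' e p z = 1 + V (e,p,z)" by (simp add: cf'_def V_def)
      have 1: "1 + D (e,p,z) / p = cp_approx e p z / p" "1 - D (e,p,z) / (1 - p) = (1 - cp_approx e p z) / (1 - p)"
        unfolding U using p by (simp_all add: field_simps)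
      have "(e, p, z) \<in> A" using * by (simp add: A_def)
      from H[OF conjI[OF *(1) conjI[OF *(2) this]]]
      show "0 < cp_approx e p z \<and> cp_approx e p z < 1 \<and> 1/2 < cf' e p z \<and> cf' e p z < 2 \<and>
        \<bar>cf e p z - z\<bar> \<le> K \<and>
        \<bar>log_density e p (cp_approx e p z) + ln (cf' e p z) + z^2 / 2 - cf_const p * e^2\<bar>
        \<le> K * (e^3 * (1 + \<bar>z\<bar>)^5)"
        unfolding log_density_def 1 V[symmetric] by simp
    qed (use b 1 in auto)
  qed
qed

section \<open>The normal and the binomial distribution function\<close>

definition Phi :: "real \<Rightarrow> real" where "Phi = cdf std_normal_distribution"

interpretation std_normal: real_distribution std_normal_distribution
  by (rule real_dist_normal_dist)

lemma Phi_diff: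
  assumes "a < b"
  shows "Phi b - Phi a = integral {a..b} std_normal_density"
proof -
  have int: "set_integrable lborel {a<..b} std_normal_density"
    unfolding set_integrable_def
    by (intro integrable_mult_indicator) auto
  have "Phi b - Phi a = measure std_normal_distribution {a<..b}"
    unfolding Phi_def by (rule std_normal.cdf_diff_eq[OF assms])
  also have "\<dots> = (LINT x|std_normal_distribution. indicator {a<..b} x)"
    by (simp)
  also have "\<dots> = (LINT x:{a<..b}|lborel. std_normal_density x)"
    unfolding set_lebesgue_integral_def
    by (subst integral_density) (auto simp: mult.commute)
  also have "\<dots> = integral {a<..b} std_normal_density"
    by (rule set_borel_integral_eq_integral(2)[OF int])
  also have "\<dots> = integral {a..b} std_normal_density"
    by (rule integral_spike_set) (auto intro: negligible_subset[OF negligible_sing[of a]])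
  finally show ?thesis .
qed

lemma continuous_on_std_normal_density: "continuous_on A std_normal_density"
  unfolding std_normal_density_def by (intro continuous_intros) auto

lemma DERIV_Phi: "(Phi has_real_derivative std_normal_density z) (at z)"
proof -
  have "((\<lambda>x. integral {z - 1..x} std_normal_density) has_real_derivative std_normal_density z) (at z within {z-1..z+1})"
    by (rule integral_has_real_derivative) (auto intro: continuous_on_std_normal_density)
  hence 1: "((\<lambda>x. integral {z - 1..x} std_normal_density) has_real_derivative std_normal_density z) (at z)"
    by (subst (asm) at_within_interior) auto
  have "((\<lambda>x. Phi (z - 1) + integral {z - 1..x} std_normal_density) has_real_derivative 0 + std_normal_density z) (at z)"
    by (intro DERIV_add DERIV_const 1)
  moreover have "eventually (\<lambda>x. Phi (z - 1) + integral {z - 1..x} std_normal_density = Phi x) (nhds z)"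
    using Phi_diff[of "z - 1"] 
    by (intro eventually_mono[OF eventually_nhds_in_open[of "{z-1<..}" z]]) (auto simp: algebra_simps)
  ultimately show ?thesis
    using DERIV_cong_ev[OF refl _ refl, of "\<lambda>x. Phi (z - 1) + integral {z - 1..x} std_normal_density" Phi z "std_normal_density z"]
    by simp
qed

lemma std_normal_density_pos: "0 < std_normal_density z"
  by (simp add: std_normal_density_def)

lemma Phi_strict_mono: "a < b \<Longrightarrow> Phi a < Phi b"
  by (rule DERIV_pos_imp_increasing) (use DERIV_Phi std_normal_density_pos in blast)+

lemma Phi_0_1: "0 \<le> Phi z" "Phi z \<le> 1"
  by (simp_all add: Phi_def std_normal.cdf_nonneg std_normal.cdf_bounded_prob)

lemma measure_std_normal_greaterThan: "measure std_normal_distribution {z<..} = 1 - Phi z"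
proof -
  have "measure std_normal_distribution (space std_normal_distribution - {..z}) = 1 - measure std_normal_distribution {..z}"
    by (rule std_normal.prob_compl) simp
  moreover have "space std_normal_distribution - {..z} = {z<..}" by auto
  ultimately show ?thesis by (simp add: Phi_def cdf_def)
qed

lemma Phi_upper_quantile:
  assumes "0 < \<alpha>" "\<alpha> < 1"
  shows "Phi (THE z. measure std_normal_distribution {z<..} = \<alpha>) = 1 - \<alpha>"
proof -
  have "eventually (\<lambda>z. Phi z < 1 - \<alpha>) at_bot"
    using std_normal.cdf_lim_at_bot unfolding Phi_def by (rule order_tendstoD) (use assms in auto)
  then obtain a where a: "Phi a < 1 - \<alpha>" by (auto simp: eventually_at_bot_linorder)
  have "eventually (\<lambda>z. Phi z > 1 - \<alpha>) at_top"
    using std_normal.cdf_lim_at_top_prob unfolding Phi_def by (rule order_tendstoD) (use assms in auto)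
  then obtain b where b: "Phi b > 1 - \<alpha>" by (auto simp: eventually_at_top_linorder)
  have "a \<le> b" using a b Phi_strict_mono[of b a] by (cases "a \<le> b") auto
  have "\<exists>z. a \<le> z \<and> z \<le> b \<and> Phi z = 1 - \<alpha>"
    by (rule IVT) (use a b \<open>a \<le> b\<close> DERIV_isCont[OF DERIV_Phi] in auto)
  then obtain z where z: "Phi z = 1 - \<alpha>" by blast
  have "(THE z. measure std_normal_distribution {z<..} = \<alpha>) = z"
  proof (rule the_equality)
    fix y assume "measure std_normal_distribution {y<..} = \<alpha>"
    hence "Phi y = Phi z" using z by (simp add: measure_std_normal_greaterThan)
    thus "y = z" using Phi_strict_mono[of y z] Phi_strict_mono[of z y] by linarith
  qed (use z in \<open>simp add: measure_std_normal_greaterThan\<close>)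
  thus ?thesis using z by simp
qed

text \<open>Markov's inequality for the sixth moment 15 = 1 * 3 * 5. The sixth power is chosen
  because Z will be e^(-1/2), which makes the bound of order e^3.\<close>

lemma Phi_tails:
  assumes "0 < Z"
  shows "Phi (-Z) \<le> 15 / Z^6" "1 - Phi Z \<le> 15 / Z^6"
proof -
  have "measure std_normal_distribution {x \<in> space std_normal_distribution. Z^6 \<le> x^6} 
      \<le> (LINT x|std_normal_distribution. x^6) / Z^6"
    using std_normal_distribution_even_moments(2)[of 3] assms
    by (intro integral_Markov_inequality_measure[where A="{}"]) auto
  also have "(LINT x|std_normal_distribution. x^6) = 15"
    using std_normal_distribution_even_moments(1)[of 3] by (simp add: fact_numeral)
  finally have M: "measure std_normal_distribution {x. Z^6 \<le> x^6} \<le> 15 / Z^6" by simp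
  have "Phi (-Z) \<le> measure std_normal_distribution {x. Z^6 \<le> x^6}"
    unfolding Phi_def cdf_def
  proof (rule std_normal.finite_measure_mono)
    show "{..- Z} \<subseteq> {x. Z ^ 6 \<le> x ^ 6}"
    proof safe
      fix x assume "x \<le> -Z"
      hence "Z^6 \<le> (-x)^6" using assms by (intro power_mono) auto
      thus "Z^6 \<le> x^6" by simp
    qed
  qed (measurable; simp)
  with M show "Phi (-Z) \<le> 15 / Z^6" by linarith
  have "measure std_normal_distribution {Z<..} \<le> measure std_normal_distribution {x. Z^6 \<le> x^6}"
    using assms by (intro std_normal.finite_measure_mono) (auto intro!: power_mono)
  with M show "1 - Phi Z \<le> 15 / Z^6" unfolding measure_std_normal_greaterThan by linarith
qed

section \<open>The binomial distribution function as a function of the success probability\<close>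

definition binomial_cdf :: "nat \<Rightarrow> nat \<Rightarrow> real \<Rightarrow> real" where
  "binomial_cdf n x u = (\<Sum>k=0..x. real (n choose k) * u ^ k * (1 - u) ^ (n - k))"

text \<open>For x < n the normalizing constant of the Beta(x + 1, n - x) density. It is never
  estimated, since it disappears in the factor C.\<close>

definition binomial_cdf_slope :: "nat \<Rightarrow> nat \<Rightarrow> real" where
  "binomial_cdf_slope n x = real (n - x) * real (n choose x)"

lemma binomial_cdf_slope_pos: "x < n \<Longrightarrow> 0 < binomial_cdf_slope n x"
  by (simp add: binomial_cdf_slope_def)

text \<open>The derivative telescopes: the positive part contributed by the new summand cancels the
  previous derivative because (x + 1) (n choose x + 1) = (n - x) (n choose x).\<close>

lemma DERIV_binomial_cdf:
  "x < n \<Longrightarrow> (binomial_cdf n x has_real_derivative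
     - (binomial_cdf_slope n x * u ^ x * (1 - u) ^ (n - x - 1))) (at u)"
proof (induction x)
  case 0
  show ?case unfolding binomial_cdf_def[abs_def] binomial_cdf_slope_def
    by (auto intro!: derivative_eq_intros)
next
  case (Suc x)
  have eq: "binomial_cdf n (Suc x) = (\<lambda>u. binomial_cdf n x u + real (n choose Suc x) * (u ^ Suc x * (1 - u) ^ (n - Suc x)))"
    by (simp add: mult.assoc binomial_cdf_def fun_eq_iff)
  have c: "real (Suc x) * real (n choose Suc x) = real (n - x) * real (n choose x)"
    unfolding of_nat_mult[symmetric] by (simp only: binomial_absorption binomial_absorb_comp)
  have IH: "(binomial_cdf n x has_real_derivative
     - (binomial_cdf_slope n x * u ^ x * (1 - u) ^ (n - x - 1))) (at u)"
    by (rule Suc.IH) (use Suc.prems in simp)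
  have "(binomial_cdf n (Suc x) has_real_derivative
      - (binomial_cdf_slope n x * u ^ x * (1 - u) ^ (n - x - 1))
      + real (n choose Suc x) * (real (Suc x) * u ^ x * (1 - u) ^ (n - Suc x)
          + - (real (n - Suc x) * (1 - u) ^ (n - Suc x - 1)) * u ^ Suc x)) (at u)"
  proof -
    have "((\<lambda>u. u ^ Suc x) has_real_derivative real (Suc x) * u ^ x) (at u)"
      using DERIV_pow[of "Suc x" u] by simp
    moreover have "((\<lambda>u. (1 - u) ^ (n - Suc x)) has_real_derivative - (real (n - Suc x) * (1 - u) ^ (n - Suc x - 1))) (at u)"
      by (auto intro!: derivative_eq_intros)
    ultimately have "((\<lambda>u. u ^ Suc x * (1 - u) ^ (n - Suc x)) has_real_derivative
        real (Suc x) * u ^ x * (1 - u) ^ (n - Suc x) + - (real (n - Suc x) * (1 - u) ^ (n - Suc x - 1)) * u ^ Suc x) (at u)"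
      by (rule DERIV_mult)
    from DERIV_add[OF IH DERIV_cmult[OF this, of "real (n choose Suc x)"]]
    show ?thesis unfolding eq .
  qed
  also have "- (binomial_cdf_slope n x * u ^ x * (1 - u) ^ (n - x - 1))
      + real (n choose Suc x) * (real (Suc x) * u ^ x * (1 - u) ^ (n - Suc x)
          + - (real (n - Suc x) * (1 - u) ^ (n - Suc x - 1)) * u ^ Suc x)
      = (real (Suc x) * real (n choose Suc x) - real (n - x) * real (n choose x)) * u ^ x * (1 - u) ^ (n - Suc x)
        - real (n - Suc x) * real (n choose Suc x) * u ^ Suc x * (1 - u) ^ (n - Suc x - 1)"
    unfolding binomial_cdf_slope_def Suc_eq_plus1 diff_diff_left by algebra
  also have "\<dots> = - (binomial_cdf_slope n (Suc x) * u ^ Suc x * (1 - u) ^ (n - Suc x - 1))"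
    by (simp only: c binomial_cdf_slope_def) simp
  finally show ?case .
qed

lemma binomial_cdf_strict_decreasing:
  assumes "x < n" "0 \<le> a" "a < b" "b \<le> 1"
  shows "binomial_cdf n x b < binomial_cdf n x a"
proof (rule DERIV_neg_imp_decreasing_open[OF assms(3)])
  fix u assume u: "a < u" "u < b"
  have "0 < binomial_cdf_slope n x * u ^ x * (1 - u) ^ (n - x - 1)"
    using u assms by (intro mult_pos_pos zero_less_power binomial_cdf_slope_pos) auto
  thus "\<exists>y. (binomial_cdf n x has_real_derivative y) (at u) \<and> y < 0"
    using DERIV_binomial_cdf[OF assms(1), of u] by (intro exI conjI) auto
qed (auto intro!: continuous_at_imp_continuous_on DERIV_isCont[OF DERIV_binomial_cdf[OF assms(1)]])

lemma binomial_cdf_0: "binomial_cdf n x 0 = 1"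
proof -
  have "binomial_cdf n x 0 = (\<Sum>k=0..x. if k = 0 then 1 else 0)"
    unfolding binomial_cdf_def by (intro sum.cong) auto
  thus ?thesis by simp
qed

lemma binomial_cdf_1: "x < n \<Longrightarrow> binomial_cdf n x 1 = 0"
  unfolding binomial_cdf_def by (intro sum.neutral) auto

lemma binomial_cdf_unique_root:
  assumes "x < n" "0 < \<alpha>" "\<alpha> < 1"
  shows "\<exists>!u. 0 < u \<and> u < 1 \<and> binomial_cdf n x u = \<alpha>"
proof (rule ex_ex1I)
  have "\<exists>u. 0 \<le> u \<and> u \<le> 1 \<and> binomial_cdf n x u = \<alpha>"
    proof (rule IVT2)
    show "\<forall>u. 0 \<le> u \<and> u \<le> 1 \<longrightarrow> isCont (binomial_cdf n x) u"
      using DERIV_isCont[OF DERIV_binomial_cdf[OF assms(1)]] by blast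
  qed (use assms binomial_cdf_0[of n x] binomial_cdf_1[of x n] in simp_all)
  then obtain u where u: "0 \<le> u" "u \<le> 1" "binomial_cdf n x u = \<alpha>" by blast
  moreover have "u \<noteq> 0" "u \<noteq> 1" using u assms binomial_cdf_0 binomial_cdf_1 by auto
  ultimately show "\<exists>u. 0 < u \<and> u < 1 \<and> binomial_cdf n x u = \<alpha>"
    by (intro exI[of _ u] conjI) auto
next
  fix u v assume "0 < u \<and> u < 1 \<and> binomial_cdf n x u = \<alpha>" "0 < v \<and> v < 1 \<and> binomial_cdf n x v = \<alpha>"
  thus "u = v"
    using binomial_cdf_strict_decreasing[OF assms(1), of u v] binomial_cdf_strict_decreasing[OF assms(1), of v u]
    by (cases u v rule: linorder_cases) auto
qed

lemma binomial_cdf_eq_prob: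
  assumes "x \<le> n" "0 \<le> u" "u \<le> 1"
  shows "binomial_cdf n x u = measure_pmf.prob (binomial_pmf n u) {..x}"
  using assms by (subst measure_measure_pmf_finite) (auto simp: binomial_cdf_def atLeast0AtMost)

text \<open>Hoeffding's inequality read with the observation fixed and the success probability u
  varying.\<close>

lemma binomial_cdf_upper_tail:
  assumes "x < n" "0 \<le> u" "u \<le> 1" "0 \<le> t" "real x / real n + t \<le> u"
  shows "binomial_cdf n x u \<le> exp (-2 * real n * t^2)"
proof -
  interpret binomial_distribution n u by unfold_locales (use assms in auto)
  have "binomial_cdf n x u \<le> measure_pmf.prob (binomial_pmf n u) {k. real k / real n \<le> u - t}"
    unfolding binomial_cdf_eq_prob[OF less_imp_le[OF assms(1)] assms(2,3)]
  proof (rule measure_pmf.finite_measure_mono)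
    show "{..x} \<subseteq> {k. real k / real n \<le> u - t}"
    proof safe
      fix k assume "k \<le> x"
      hence "real k / real n \<le> real x / real n" by (intro divide_right_mono) auto
      thus "real k / real n \<le> u - t" using assms(5) by linarith
    qed
  qed auto
  also have "\<dots> \<le> exp (-2 * real n * t^2)" using prob_le'[of t] assms by auto
  finally show ?thesis .
qed

lemma binomial_cdf_lower_tail:
  assumes "x < n" "0 \<le> u" "u \<le> 1" "0 \<le> t" "u + t \<le> real x / real n"
  shows "1 - binomial_cdf n x u \<le> exp (-2 * real n * t^2)"
proof -
  interpret binomial_distribution n u by unfold_locales (use assms in auto)
  have "1 - binomial_cdf n x u = measure_pmf.prob (binomial_pmf n u) (UNIV - {..x})"
    unfolding binomial_cdf_eq_prob[OF less_imp_le[OF assms(1)] assms(2,3)]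
    using measure_pmf.prob_compl[of "{..x}" "binomial_pmf n u"] by simp
  also have "\<dots> \<le> measure_pmf.prob (binomial_pmf n u) {k. real k / real n \<ge> u + t}"
  proof (rule measure_pmf.finite_measure_mono)
    show "UNIV - {..x} \<subseteq> {k. real k / real n \<ge> u + t}"
    proof safe
      fix k assume "\<not> k \<le> x"
      hence "real x / real n \<le> real k / real n" by (intro divide_right_mono) auto
      thus "real k / real n \<ge> u + t" using assms(5) by linarith
    qed
  qed auto
  also have "\<dots> \<le> exp (-2 * real n * t^2)" using prob_ge'[of t] assms by auto
  finally show ?thesis .
qed

section \<open>Comparison of distribution functions\<close>

text \<open>The weight times 1 + z^2 is at most (1 + |z|)^7 \<le> exp (7 |z|), and 7 |z| - z^2 / 2
  has maximum 49/2, at |z| = 7. The dominating function 1 / (1 + z^2) has the explicit primitive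
  arctan.\<close>

lemma std_normal_density_mult_power_le:
  "std_normal_density z * (1 + \<bar>z\<bar>)^5 \<le> exp (49/2) / (1 + z^2)"
proof -
  have "0 \<le> (\<bar>z\<bar> - 7)^2" by simp
  hence "7 * \<bar>z\<bar> - z^2 / 2 \<le> 49/2" by (simp add: power2_eq_square algebra_simps)
  hence le: "exp (7 * \<bar>z\<bar> - z^2 / 2) \<le> exp (49/2)" by simp
  have "std_normal_density z \<le> exp (- (z^2) / 2)"
  proof -
    have "1 \<le> sqrt (2 * pi)" using pi_gt3 by simp
    thus ?thesis by (simp add: std_normal_density_def divide_simps)
  qed
  moreover have "(1 + \<bar>z\<bar>)^5 * (1 + z^2) \<le> exp (7 * \<bar>z\<bar>)"
  proof -
    have "1 + z^2 \<le> (1 + \<bar>z\<bar>)^2" by (simp add: power2_eq_square algebra_simps)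
    hence "(1 + \<bar>z\<bar>)^5 * (1 + z^2) \<le> (1 + \<bar>z\<bar>)^5 * (1 + \<bar>z\<bar>)^2"
      by (intro mult_left_mono) auto
    also have "\<dots> = (1 + \<bar>z\<bar>)^7" by (simp flip: power_add)
    also have "\<dots> \<le> exp \<bar>z\<bar> ^ 7" by (intro power_mono) (auto simp: exp_ge_add_one_self)
    also have "\<dots> = exp (7 * \<bar>z\<bar>)" by (simp flip: exp_of_nat_mult)
    finally show ?thesis .
  qed
  ultimately have "std_normal_density z * ((1 + \<bar>z\<bar>)^5 * (1 + z^2)) \<le> exp (- (z^2) / 2) * exp (7 * \<bar>z\<bar>)"
    by (intro mult_mono) auto
  also have "\<dots> = exp (7 * \<bar>z\<bar> - z^2 / 2)" by (simp flip: exp_add add: algebra_simps)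
  finally have "std_normal_density z * ((1 + \<bar>z\<bar>)^5 * (1 + z^2)) \<le> exp (49/2)" using le by linarith
  thus ?thesis by (simp add: pos_le_divide_eq add_pos_nonneg mult.assoc)
qed

lemma abs_exp_minus_1_le: "\<bar>exp r - 1\<bar> \<le> \<bar>r\<bar> * exp \<bar>r\<bar>" for r :: real
proof (cases "0 \<le> r")
  case True
  have "1 - r \<le> exp (- r)" using exp_ge_add_one_self[of "-r"] by simp
  hence "(1 - r) * exp r \<le> exp (-r) * exp r" by (intro mult_right_mono) auto
  also have "\<dots> = 1" by (simp flip: exp_add)
  finally show ?thesis using True by (simp add: algebra_simps)
next
  case False
  hence "1 - exp r \<le> - r" using exp_ge_add_one_self[of r] by linarith
  also have "\<dots> \<le> - r * exp (- r)" using False by (simp add: mult_le_cancel_left1)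
  finally show ?thesis using False by simp
qed

text \<open>Cube of 1 + y/3 \<le> exp (y/3). The third power makes a tail exp (-c / e) of order
  e^3.\<close>

lemma exp_minus_le_inverse_cube:
  fixes y :: real
  assumes "0 < y"
  shows "exp (- y) \<le> 27 / y ^ 3"
proof -
  have "(y / 3) ^ 3 \<le> exp (y / 3) ^ 3"
    using assms exp_ge_add_one_self[of "y / 3"] by (intro power_mono) linarith+
  also have "\<dots> = exp y" by (simp flip: exp_of_nat_mult)
  finally have "y ^ 3 \<le> 27 * exp y" by (simp add: power_divide)
  thus ?thesis using assms by (simp add: exp_minus field_simps)
qed

text \<open>The error bound \<open>c / (1 + z\<^sup>2)\<close> is the derivative of \<open>c arctan z\<close>, so monotonicity replaces integration.\<close>

lemma deriv_comparison:
  fixes H h :: "real \<Rightarrow> real"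
  assumes "a \<le> b" "0 \<le> c"
    and "\<And>z. a \<le> z \<Longrightarrow> z \<le> b \<Longrightarrow> (H has_real_derivative h z) (at z)"
    and "\<And>z. a \<le> z \<Longrightarrow> z \<le> b \<Longrightarrow> \<bar>h z - C * std_normal_density z\<bar> \<le> c / (1 + z^2)"
  shows "\<bar>H b - H a - C * (Phi b - Phi a)\<bar> \<le> 4 * c"
proof -
  \<comment> \<open>The total variation of arctan is \<pi>, rounded up to 4.\<close>
  have at: "c * arctan b - c * arctan a \<le> 4 * c"
  proof -
    have "arctan b - arctan a \<le> 4"
      using arctan_ubound[of b] arctan_lbound[of a] pi_less_4 by linarith
    hence "c * (arctan b - arctan a) \<le> c * 4" using assms by (intro mult_left_mono) auto
    thus ?thesis by (simp add: algebra_simps)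
  qed
  have "(\<lambda>z. H z - C * Phi z - c * arctan z) b \<le> (\<lambda>z. H z - C * Phi z - c * arctan z) a"
  proof (rule DERIV_nonpos_imp_nonincreasing[OF assms(1)])
    fix z assume z: "a \<le> z" "z \<le> b"
    have "((\<lambda>z. H z - C * Phi z - c * arctan z) has_real_derivative
        (h z - C * std_normal_density z - c * inverse (1 + z^2))) (at z)"
      by (intro DERIV_diff DERIV_cmult assms(3) z DERIV_Phi DERIV_arctan)
    moreover have "h z - C * std_normal_density z - c * inverse (1 + z^2) \<le> 0"
      using assms(4)[OF z] by (simp add: field_simps abs_le_iff)
    ultimately show "\<exists>y. ((\<lambda>z. H z - C * Phi z - c * arctan z) has_real_derivative y) (at z) \<and> y \<le> 0"
      by blast
  qed
  moreover have "(\<lambda>z. H z - C * Phi z + c * arctan z) a \<le> (\<lambda>z. H z - C * Phi z + c * arctan z) b"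
  proof (rule DERIV_nonneg_imp_nondecreasing[OF assms(1)])
    fix z assume z: "a \<le> z" "z \<le> b"
    have "((\<lambda>z. H z - C * Phi z + c * arctan z) has_real_derivative
        (h z - C * std_normal_density z + c * inverse (1 + z^2))) (at z)"
      by (intro DERIV_diff DERIV_add DERIV_cmult assms(3) z DERIV_Phi DERIV_arctan)
    moreover have "h z - C * std_normal_density z + c * inverse (1 + z^2) \<ge> 0"
      using assms(4)[OF z] by (simp add: field_simps abs_le_iff)
    ultimately show "\<exists>y. ((\<lambda>z. H z - C * Phi z + c * arctan z) has_real_derivative y) (at z) \<and> y \<ge> 0"
      by blast
  qed
  ultimately show ?thesis using at by (simp add: algebra_simps abs_le_iff)
qed

text \<open>The unknown factor \<open>C\<close> is recovered from the fact that both distributions have almost all of their mass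
  on \<open>[-Z, Z]\<close>.\<close>

lemma cdf_comparison:
  fixes H h :: "real \<Rightarrow> real"
  assumes Z: "\<bar>z\<bar> \<le> Z" and C: "0 < C" and d: "0 \<le> \<delta>" "\<delta> \<le> 1/16" and t: "\<tau> \<le> 1/8"
    and H: "0 \<le> H (-Z)" "H (-Z) \<le> \<tau>" "1 - \<tau> \<le> H Z" "H Z \<le> 1"
    and P: "Phi (-Z) \<le> \<tau>" "1 - Phi Z \<le> \<tau>"
    and der: "\<And>z. \<bar>z\<bar> \<le> Z \<Longrightarrow> (H has_real_derivative h z) (at z)"
    and bound: "\<And>z. \<bar>z\<bar> \<le> Z \<Longrightarrow> \<bar>h z - C * std_normal_density z\<bar> \<le> C * \<delta> / (1 + z^2)"
  shows "\<bar>H z - Phi z\<bar> \<le> 8 * \<tau> + 16 * \<delta>"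
proof -
  define P1 where "P1 = Phi Z - Phi (-Z)"
  have P1: "1 - 2 * \<tau> \<le> P1" "P1 \<le> 1"
    using P Phi_0_1[of Z] Phi_0_1[of "-Z"] by (auto simp: P1_def)
  have full: "\<bar>H Z - H (-Z) - C * P1\<bar> \<le> 4 * (C * \<delta>)"
    unfolding P1_def by (rule deriv_comparison[where h = h]) (use Z C d der bound in auto)
  have part: "\<bar>H z - H (-Z) - C * (Phi z - Phi (-Z))\<bar> \<le> 4 * (C * \<delta>)"
    by (rule deriv_comparison[where h = h]) (use Z C d der bound in auto)
  \<comment> \<open>The comparison error is proportional to C itself, so C must first be bounded
    crudely: 3/4 C \<le> C P1 \<le> 1 + C/4 gives C \<le> 2. Only then does the mass balance yield C
    = 1 + O(\<tau> + \<delta>).\<close>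
  have Cd: "C * \<delta> \<le> C * (1/16)" using C d by (intro mult_left_mono) auto
  have CP: "C * (3/4) \<le> C * P1" using C P1 t by (intro mult_left_mono) auto
  have "C * P1 - C / 4 \<le> 1" using full H Cd by linarith
  hence C2: "C \<le> 2" using CP by linarith
  hence Cd2: "C * \<delta> \<le> 2 * \<delta>" using d by (intro mult_right_mono) auto
  have tau: "0 \<le> \<tau>" using H by linarith
  have "C * (1 - P1) \<le> 2 * (2 * \<tau>)" using C2 C P1 tau by (intro mult_mono) auto
  moreover have "0 \<le> C * (1 - P1)" using C P1 by simp
  ultimately have C1: "\<bar>C - 1\<bar> \<le> 6 * \<tau> + 8 * \<delta>"
    using full H Cd2 by (simp add: algebra_simps abs_le_iff)
  have "z = -Z \<or> -Z < z" using Z by linarith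
  hence "Phi (-Z) \<le> Phi z"
    using Phi_strict_mono[of "-Z" z] by auto
  hence "0 \<le> Phi z - Phi (-Z)" "Phi z - Phi (-Z) \<le> 1"
    using Phi_0_1[of z] Phi_0_1[of "-Z"] by auto
  hence "\<bar>C - 1\<bar> * \<bar>Phi z - Phi (-Z)\<bar> \<le> (6 * \<tau> + 8 * \<delta>) * 1"
    using C1 by (intro mult_mono) auto
  hence "\<bar>(C - 1) * (Phi z - Phi (-Z))\<bar> \<le> 6 * \<tau> + 8 * \<delta>" by (simp add: abs_mult)
  moreover have "H z - Phi z = (H z - H (-Z) - C * (Phi z - Phi (-Z))) + H (-Z) - Phi (-Z) + (C - 1) * (Phi z - Phi (-Z))"
    by (simp add: algebra_simps)
  ultimately show ?thesis using part Cd2 H P Phi_0_1[of "-Z"] by linarith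
qed

section \<open>Coverage of the Cornish--Fisher point\<close>

lemma binomial_kernel_eq_log_density:
  assumes "0 < x" "x < n" "0 < u" "u < 1"
  defines "p \<equiv> real x / real n" and "e \<equiv> 1 / sqrt (real n)"
  shows "u ^ x * (1 - u) ^ (n - x - 1) = p ^ x * (1 - p) ^ (n - x - 1) * exp (log_density e p u)"
proof -
  have p: "0 < p" "p < 1" using assms by (auto simp: p_def)
  have n: "real n > 0" using assms by auto
  have e: "1 / e^2 = real n" using n by (simp add: e_def power_divide)
  have np: "real n * p = real x" "real n * (1 - p) = real (n - x)"
    using assms by (auto simp: p_def field_simps of_nat_diff)
  have "log_density e p u = real n * (p * ln (u / p) + (1 - p) * ln ((1 - u) / (1 - p))) - ln ((1 - u) / (1 - p))"
    unfolding log_density_def e[symmetric] by simp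
  also have "\<dots> = (real n * p) * ln (u / p) + (real n * (1 - p)) * ln ((1 - u) / (1 - p)) - ln ((1 - u) / (1 - p))"
    by (simp only: distrib_left mult.assoc)
  also have "\<dots> = real x * ln (u / p) + real (n - x - 1) * ln ((1 - u) / (1 - p))"
    unfolding np using assms by (simp add: of_nat_diff algebra_simps)
  finally have ld: "log_density e p u = real x * ln (u / p) + real (n - x - 1) * ln ((1 - u) / (1 - p))" .
  have "exp (real k * ln y) = y ^ k" if "0 < y" for k y
    using that by (simp add: exp_of_nat_mult)
  hence "exp (log_density e p u) = (u / p) ^ x * ((1 - u) / (1 - p)) ^ (n - x - 1)"
    unfolding ld exp_add using p assms(3,4) by simp
  thus ?thesis using p by (simp add: power_divide)
qed

text \<open>With w = max 1 |z|, e^3 w^5 \<le> (e w^2)^3 \<le> 1, and 32 = 2^5 comes from 1 + |z|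
  \<le> 2 w. This bounds the exponent error r, so that |exp r - 1| is linear in |r|.\<close>

lemma remainder_weight_le:
  fixes e z :: real
  assumes "0 < e" "e \<le> 1" "e * z^2 \<le> 1"
  shows "e^3 * (1 + \<bar>z\<bar>)^5 \<le> 32"
proof -
  define w where "w = max 1 \<bar>z\<bar>"
  have w: "1 \<le> w" "e * w^2 \<le> 1" using assms by (auto simp: w_def max_def)
  have "(1 + \<bar>z\<bar>)^5 \<le> (2 * w)^5" by (intro power_mono) (auto simp: w_def)
  hence "e^3 * (1 + \<bar>z\<bar>)^5 \<le> e^3 * (2 * w)^5" using assms by (intro mult_left_mono) auto
  also have "\<dots> = 32 * (e^3 * w^5)" by (simp add: power_mult_distrib)
  also have "e^3 * w^5 \<le> e^3 * w^6" using assms w by (intro mult_left_mono power_increasing) auto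
  also have "e^3 * w^6 = (e * w^2)^3" by (simp add: power_mult_distrib flip: power_mult)
  also have "\<dots> \<le> 1" using w assms by (intro power_le_one) auto
  finally show ?thesis by simp
qed

lemma cp_approx_coverage:
  assumes eta: "0 < \<eta>"
  obtains K e0 :: real where "0 < e0" "0 < K"
    "\<And>n x z. 0 < n \<Longrightarrow> 1 / sqrt (real n) < e0 \<Longrightarrow> \<eta> \<le> real x / real n \<Longrightarrow> real x / real n \<le> 1 - \<eta>
      \<Longrightarrow> 1 / sqrt (real n) * z^2 \<le> 1 \<Longrightarrow>
      \<bar>1 - binomial_cdf n x (cp_approx (1 / sqrt (real n)) (real x / real n) z) - Phi z\<bar> \<le> K * (1 / sqrt (real n))^3"
proof -
  obtain K e1 where K: "0 < e1" "0 < K" and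
    R: "\<And>e p z. 0 < e \<Longrightarrow> e < e1 \<Longrightarrow> \<eta> \<le> p \<Longrightarrow> p \<le> 1 - \<eta> \<Longrightarrow> e * z^2 \<le> 1 \<Longrightarrow>
      0 < cp_approx e p z \<and> cp_approx e p z < 1 \<and> 1/2 < cf' e p z \<and> cf' e p z < 2 \<and>
      \<bar>cf e p z - z\<bar> \<le> K \<and>
      \<bar>log_density e p (cp_approx e p z) + ln (cf' e p z) + z^2 / 2 - cf_const p * e^2\<bar>
        \<le> K * (e^3 * (1 + \<bar>z\<bar>)^5)"
    by (rule cf_uniform[OF eta]) (rule that; assumption)
  \<comment> \<open>\<open>K * exp (32 * K)\<close> comes from |exp r - 1| \<le> |r| exp |r| with
    |r| \<le> 32 K, and \<open>exp (49/2)\<close> from the weighted normal density. In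
    \<open>T\<close>, 15 serves the normal tail and 216 = 27 * 2^3 the Hoeffding bound.\<close>
  define L where "L = K * exp (32 * K) * exp (49/2)"
  define T where "T = max 15 (216 / \<eta>^6)"
  have L: "0 < L" using K by (simp add: L_def)
  have T: "15 \<le> T" "216 / \<eta>^6 \<le> T" by (auto simp: T_def)
  \<comment> \<open>The third bound ensures 2 K \<le> Z; the last two ensure \<delta> \<le> 1/16 and
    \<tau> \<le> 1/8 in \<open>cdf_comparison\<close>.\<close>
  define e0 where "e0 = Min {e1, 1, 1 / (4 * K^2), 1 / (16 * L), 1 / (8 * T)}"
  have e0: "0 < e0" "e0 \<le> e1" "e0 \<le> 1" "e0 \<le> 1 / (4 * K^2)" "e0 \<le> 1 / (16 * L)" "e0 \<le> 1 / (8 * T)"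
    using K L T by (auto simp: e0_def)
  show thesis
  proof (rule that[of e0 "8 * T + 16 * L"])
    fix n x :: nat and z :: real
    assume n: "0 < n" and e0': "1 / sqrt (real n) < e0"
      and p_range: "\<eta> \<le> real x / real n" "real x / real n \<le> 1 - \<eta>"
      and z: "1 / sqrt (real n) * z^2 \<le> 1"
    define e where "e = 1 / sqrt (real n)"
    define p where "p = real x / real n"
    have e: "0 < e" "e < e0" "1 / e^2 = real n" using n e0' by (auto simp: e_def power_divide)
    have e_le: "e < e1" "e \<le> 1" "e \<le> 1 / (4 * K^2)" "e \<le> 1 / (16 * L)" "e \<le> 1 / (8 * T)"
      using e e0 by auto
    have e3: "e^3 \<le> e" using e e_le power_decreasing[of 1 3 e] by simp
    have p: "\<eta> \<le> p" "p \<le> 1 - \<eta>" "0 < p" "p < 1" using p_range eta by (auto simp: p_def)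
    have x: "0 < x" "x < n" using p n by (auto simp: p_def field_simps)
    define s where "s = sqrt (p * (1 - p))"
    have s: "\<eta> \<le> s"
    proof -
      have "\<eta> * \<eta> \<le> p * (1 - p)" using p eta by (intro mult_mono) auto
      hence "sqrt (\<eta> * \<eta>) \<le> s" unfolding s_def by (rule real_sqrt_le_mono)
      thus ?thesis using eta by simp
    qed
    define U where "U = cp_approx e p"
    define Z where "Z = 1 / sqrt e"
    have Z: "0 < Z" "e * Z^2 = 1" using e by (auto simp: Z_def power_divide)
    have zZ: "e * y^2 \<le> 1" if "\<bar>y\<bar> \<le> Z" for y
    proof -
      have "e * y^2 \<le> e * Z^2"
        using that e Z by (intro mult_left_mono) (simp_all add: power2_le_iff_abs_le)
      thus ?thesis using Z by simp
    qed
    have z': "\<bar>z\<bar> \<le> Z"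
    proof -
      have "e * z^2 \<le> e * Z^2" using z Z by (simp add: e_def)
      hence "z^2 \<le> Z^2" using e by simp
      thus ?thesis using Z by (simp add: power2_le_iff_abs_le)
    qed
    note R' = R[OF e(1) e_le(1) p(1,2) zZ]
    define H where "H = (\<lambda>z. 1 - binomial_cdf n x (U z))"
    define h where "h = (\<lambda>z. binomial_cdf_slope n x * U z ^ x * (1 - U z) ^ (n - x - 1) * (e * s * cf' e p z))"
    \<comment> \<open>All factors of \<open>h\<close> that are free of z: Beta constant, kernel at
      p, the factor e s of the Jacobian, the constant of order e^2, and sqrt (2 \<pi>) to normalize
      the Gaussian.\<close>
    define C where "C = binomial_cdf_slope n x * p ^ x * (1 - p) ^ (n - x - 1) * e * s * exp (cf_const p * e^2) * sqrt (2 * pi)"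
    have C: "0 < C"
      unfolding C_def using x p e s eta by (intro mult_pos_pos binomial_cdf_slope_pos zero_less_power) auto
    have der: "(H has_real_derivative h y) (at y)" for y
    proof -
      have "(U has_real_derivative e * s * cf' e p y) (at y)"
        unfolding U_def s_def by (rule DERIV_cp_approx)
      from DERIV_chain2[OF DERIV_binomial_cdf[OF x(2)] this]
      have "((\<lambda>z. 1 - binomial_cdf n x (U z)) has_real_derivative
        0 - (- (binomial_cdf_slope n x * U y ^ x * (1 - U y) ^ (n - x - 1)) * (e * s * cf' e p y))) (at y)"
        by (intro DERIV_diff DERIV_const)
      thus ?thesis unfolding H_def h_def by simp
    qed
    have bound: "\<bar>h y - C * std_normal_density y\<bar> \<le> C * (L * e^3) / (1 + y^2)" if y: "\<bar>y\<bar> \<le> Z" for y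
    proof -
      define r where "r = log_density e p (U y) + ln (cf' e p y) + y^2 / 2 - cf_const p * e^2"
      have r: "\<bar>r\<bar> \<le> K * (e^3 * (1 + \<bar>y\<bar>)^5)" using R'[OF y] by (auto simp: r_def U_def)
      also have "\<dots> \<le> K * 32" using remainder_weight_le[OF e(1) e_le(2) zZ[OF y]] K by (intro mult_left_mono) auto
      finally have r32: "\<bar>r\<bar> \<le> 32 * K" by simp
      have U: "0 < U y" "U y < 1" and cf': "0 < cf' e p y" using R'[OF y] by (auto simp: U_def)
      have "h y = binomial_cdf_slope n x * (U y ^ x * (1 - U y) ^ (n - x - 1)) * (e * s * cf' e p y)"
        by (simp add: h_def)
      also have "\<dots> = binomial_cdf_slope n x * (p ^ x * (1 - p) ^ (n - x - 1)) * (e * s) * (exp (log_density e p (U y)) * cf' e p y)"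
        using binomial_kernel_eq_log_density[OF x U] by (simp add: p_def e_def)
      also have "exp (log_density e p (U y)) * cf' e p y = exp (cf_const p * e^2) * exp (- (y^2) / 2) * exp r"
        using cf' by (simp add: r_def flip: exp_add) (simp add: exp_add)
      also have "exp (- (y^2) / 2) = sqrt (2 * pi) * std_normal_density y"
        by (simp add: std_normal_density_def)
      finally have h: "h y = C * std_normal_density y * exp r"
        by (simp add: C_def)
      have "\<bar>exp r - 1\<bar> \<le> \<bar>r\<bar> * exp \<bar>r\<bar>" by (rule abs_exp_minus_1_le)
      also have "\<dots> \<le> (K * (e^3 * (1 + \<bar>y\<bar>)^5)) * exp (32 * K)"
        using r r32 K e by (intro mult_mono) auto
      finally have er: "\<bar>exp r - 1\<bar> \<le> K * exp (32 * K) * e^3 * (1 + \<bar>y\<bar>)^5" by (simp add: mult_ac)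
      have "\<bar>h y - C * std_normal_density y\<bar> = C * (std_normal_density y * \<bar>exp r - 1\<bar>)"
      proof -
        have "h y - C * std_normal_density y = C * (std_normal_density y * (exp r - 1))"
          unfolding h by (simp add: algebra_simps)
        thus ?thesis using C std_normal_density_pos[of y] by (simp add: abs_mult)
      qed
      also have "\<dots> \<le> C * (std_normal_density y * (K * exp (32 * K) * e^3 * (1 + \<bar>y\<bar>)^5))"
        using C std_normal_density_pos[of y] er by (intro mult_left_mono) auto
      also have "\<dots> = C * (K * exp (32 * K) * e^3) * (std_normal_density y * (1 + \<bar>y\<bar>)^5)"
        by (simp add: mult_ac)
      also have "\<dots> \<le> C * (K * exp (32 * K) * e^3) * (exp (49/2) / (1 + y^2))"
        using C K e by (intro mult_left_mono std_normal_density_mult_power_le) auto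
      also have "\<dots> = C * (L * e^3) / (1 + y^2)" by (simp add: L_def)
      finally show ?thesis .
    qed
    have KZ: "2 * K \<le> Z"
    proof -
      have "(2 * K)^2 * e \<le> 1" using e_le(3) K by (simp add: field_simps)
      hence "e * (2 * K)^2 \<le> e * Z^2" using Z by (simp add: mult.commute)
      hence "(2 * K)^2 \<le> Z^2" using e by simp
      thus ?thesis by (rule power2_le_imp_le) (use Z in simp)
    qed
    \<comment> \<open>Lower bound for the distance from p to U(Z) and U(-Z): |cf| \<ge> Z - K \<ge>
      Z/2 there, and s \<ge> \<eta>. The Hoeffding exponent 2 n t^2 then equals \<eta>^2 / (2
      e).\<close>
    define t where "t = e * \<eta> * (Z / 2)"
    have t: "0 \<le> t" using e eta Z by (simp add: t_def)
    have tail: "exp (-2 * real n * t^2) \<le> T * e^3"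
    proof -
      have "2 * real n * t^2 = \<eta>^2 * (e * Z^2) / (2 * e)"
        unfolding e(3)[symmetric] t_def using e(1)
        by (simp add: power_mult_distrib power2_eq_square)
      also have "\<dots> = \<eta>^2 / (2 * e)" using Z by simp
      finally have "exp (-2 * real n * t^2) = exp (- (\<eta>^2 / (2 * e)))" by simp
      also have "\<dots> \<le> 27 / (\<eta>^2 / (2 * e))^3"
        using eta e by (intro exp_minus_le_inverse_cube) auto
      also have "\<dots> = 216 / \<eta>^6 * e^3" by (simp add: power_divide power_mult_distrib flip: power_mult)
      also have "\<dots> \<le> T * e^3" using T e by (intro mult_right_mono) auto
      finally show ?thesis .
    qed
    have shift: "t \<le> e * s * w" if "Z - K \<le> w" for w
    proof -
      have "\<eta> * (Z / 2) \<le> s * w" using that s eta KZ Z by (intro mult_mono) auto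
      thus ?thesis using e by (simp add: t_def mult.assoc)
    qed
    have low: "1 - binomial_cdf n x (U (-Z)) \<le> T * e^3"
    proof -
      have u: "0 < U (-Z)" "U (-Z) < 1" "\<bar>cf e p (-Z) - (-Z)\<bar> \<le> K"
        using R'[of "-Z"] Z by (auto simp: U_def)
      have "t \<le> e * s * (- cf e p (-Z))" using u by (intro shift) auto
      hence "U (-Z) + t \<le> p" by (simp add: U_def cp_approx_def s_def)
      hence "1 - binomial_cdf n x (U (-Z)) \<le> exp (-2 * real n * t^2)"
        using u by (intro binomial_cdf_lower_tail x t) (auto simp: p_def)
      thus ?thesis using tail by linarith
    qed
    have high: "binomial_cdf n x (U Z) \<le> T * e^3"
    proof -
      have u: "0 < U Z" "U Z < 1" "\<bar>cf e p Z - Z\<bar> \<le> K"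
        using R'[of Z] Z by (auto simp: U_def)
      have "t \<le> e * s * cf e p Z" using u by (intro shift) auto
      hence "p + t \<le> U Z" by (simp add: U_def cp_approx_def s_def)
      hence "binomial_cdf n x (U Z) \<le> exp (-2 * real n * t^2)"
        using u by (intro binomial_cdf_upper_tail x t) (auto simp: p_def)
      thus ?thesis using tail by linarith
    qed
    have range: "0 \<le> H y" "H y \<le> 1" if "\<bar>y\<bar> \<le> Z" for y
      using R'[OF that] x binomial_cdf_eq_prob[of x n "U y"] by (auto simp: H_def U_def)
    have Z6: "15 / Z^6 \<le> T * e^3"
    proof -
      have "(e * Z^2)^3 = e^3 * Z^6" by (simp add: power_mult_distrib flip: power_mult)
      hence "e^3 = 1 / Z^6" using Z by (simp add: field_simps)
      hence "15 / Z^6 = 15 * e^3" by simp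
      also have "\<dots> \<le> T * e^3" using T e by (intro mult_right_mono) auto
      finally show ?thesis .
    qed
    have small: "L * e^3 \<le> 1/16" "T * e^3 \<le> 1/8"
    proof -
      have "L * e^3 \<le> L * (1 / (16 * L))" using L e3 e_le by (intro mult_left_mono) auto
      thus "L * e^3 \<le> 1/16" using L by simp
      have "T * e^3 \<le> T * (1 / (8 * T))" using T e3 e_le by (intro mult_left_mono) auto
      thus "T * e^3 \<le> 1/8" using T by simp
    qed
    have "\<bar>H z - Phi z\<bar> \<le> 8 * (T * e^3) + 16 * (L * e^3)"
      by (rule cdf_comparison[where Z = Z and C = C and h = h])
         (use z' C L e small range[of Z] range[of "-Z"] low high Z Z6 Phi_tails[of Z] der bound in \<open>auto simp: H_def\<close>)
    thus "\<bar>1 - binomial_cdf n x (cp_approx (1 / sqrt (real n)) (real x / real n) z) - Phi z\<bar>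
        \<le> (8 * T + 16 * L) * (1 / sqrt (real n))^3"
      by (simp add: H_def U_def e_def p_def algebra_simps)
  qed (use e0 L T in auto)
qed

section \<open>Expansion of the Clopper--Pearson bound\<close>

lemma cp_upper_eq_binomial_cdf_root:
  assumes "x < n" "0 < \<alpha>" "\<alpha> < 1"
  shows "0 < cp_upper n \<alpha> x" "cp_upper n \<alpha> x < 1" "binomial_cdf n x (cp_upper n \<alpha> x) = \<alpha>"
proof -
  have "cp_upper n \<alpha> x = (THE u. 0 < u \<and> u < 1 \<and> binomial_cdf n x u = \<alpha>)"
    using assms(1) by (simp add: cp_upper_def binomial_cdf_def)
  with theI'[OF binomial_cdf_unique_root[OF assms]]
  show "0 < cp_upper n \<alpha> x" "cp_upper n \<alpha> x < 1" "binomial_cdf n x (cp_upper n \<alpha> x) = \<alpha>"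
    by simp_all
qed

lemma std_normal_density_antimono:
  assumes "\<bar>y\<bar> \<le> w" shows "std_normal_density w \<le> std_normal_density y"
proof -
  have "y^2 \<le> w^2" using assms by (simp add: power2_le_iff_abs_le)
  thus ?thesis by (simp add: std_normal_density_def divide_right_mono)
qed

lemma Phi_diff_ge:
  assumes "a \<le> b" "\<And>y. a \<le> y \<Longrightarrow> y \<le> b \<Longrightarrow> \<bar>y\<bar> \<le> w"
  shows "std_normal_density w * (b - a) \<le> Phi b - Phi a"
proof (cases "a = b")
  case False
  hence ab: "a < b" using assms by simp
  obtain y where "a < y" "y < b" "Phi b - Phi a = (b - a) * std_normal_density y"
    using MVT2[OF ab, of Phi std_normal_density] DERIV_Phi by blast
  moreover have "std_normal_density w \<le> std_normal_density y"
    using assms(2)[of y] \<open>a < y\<close> \<open>y < b\<close> by (intro std_normal_density_antimono) auto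
  ultimately show ?thesis using ab by (simp add: mult.commute mult_left_mono)
qed simp

text \<open>The bound is trapped between U(z - \<delta>) and U(z + \<delta>) by monotonicity of the
  binomial distribution function. As U has slope O(e), the error e^3 in coverage becomes an error
  e^4 in the bound.\<close>

lemma cp_upper_expansion:
  assumes eta: "0 < \<eta>" and alpha: "0 < \<alpha>" "\<alpha> < 1" and z: "Phi z = 1 - \<alpha>"
  obtains K e0 :: real where "0 < e0" "0 < K"
    "\<And>n x. 0 < n \<Longrightarrow> 1 / sqrt (real n) < e0 \<Longrightarrow> \<eta> \<le> real x / real n \<Longrightarrow> real x / real n \<le> 1 - \<eta> \<Longrightarrow>
      \<bar>cp_upper n \<alpha> x - cp_approx (1 / sqrt (real n)) (real x / real n) z\<bar> \<le> K * (1 / sqrt (real n))^4"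
proof -
  obtain K e1 where K: "0 < e1" "0 < K" and
    R: "\<And>n x z. 0 < n \<Longrightarrow> 1 / sqrt (real n) < e1 \<Longrightarrow> \<eta> \<le> real x / real n \<Longrightarrow> real x / real n \<le> 1 - \<eta>
      \<Longrightarrow> 1 / sqrt (real n) * z^2 \<le> 1 \<Longrightarrow>
      \<bar>1 - binomial_cdf n x (cp_approx (1 / sqrt (real n)) (real x / real n) z) - Phi z\<bar> \<le> K * (1 / sqrt (real n))^3"
    by (rule cp_approx_coverage[OF eta]) (rule that; assumption)
  obtain K' e2 where K': "0 < e2" "0 < K'" and
    R': "\<And>e p z. 0 < e \<Longrightarrow> e < e2 \<Longrightarrow> \<eta> \<le> p \<Longrightarrow> p \<le> 1 - \<eta> \<Longrightarrow> e * z^2 \<le> 1 \<Longrightarrow>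
      0 < cp_approx e p z \<and> cp_approx e p z < 1 \<and> 1/2 < cf' e p z \<and> cf' e p z < 2 \<and>
      \<bar>cf e p z - z\<bar> \<le> K' \<and>
      \<bar>log_density e p (cp_approx e p z) + ln (cf' e p z) + z^2 / 2 - cf_const p * e^2\<bar>
        \<le> K' * (e^3 * (1 + \<bar>z\<bar>)^5)"
    by (rule cf_uniform[OF eta]) (rule that; assumption)
  \<comment> \<open>Leaves room for z - \<delta> and z + \<delta> with \<delta> \<le> 1;
    \<open>m\<close> is then a lower bound for the slope of \<open>Phi\<close> on [-w, w].\<close>
  define w where "w = \<bar>z\<bar> + 1"
  define m where "m = std_normal_density w"
  have m: "0 < m" by (simp add: m_def std_normal_density_pos)
  have w: "1 \<le> w" by (simp add: w_def)
  define e0 where "e0 = Min {e1, e2, 1, 1 / w^2, m / (2 * K)}"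
  have e0: "0 < e0" "e0 \<le> e1" "e0 \<le> e2" "e0 \<le> 1" "e0 \<le> 1 / w^2" "e0 \<le> m / (2 * K)"
    using K K' w m by (auto simp: e0_def)
  show thesis
  proof (rule that[of e0 "4 * K / m"])
    fix n x :: nat
    assume n: "0 < n" and e0': "1 / sqrt (real n) < e0"
      and p_range: "\<eta> \<le> real x / real n" "real x / real n \<le> 1 - \<eta>"
    define e where "e = 1 / sqrt (real n)"
    define p where "p = real x / real n"
    define U where "U = cp_approx e p"
    \<comment> \<open>Moving z by \<delta> changes \<open>Phi\<close> by at least m \<delta> = 2 K
      e^3, twice the coverage error, which leaves a strict gap for the contradictions below.\<close>
    define \<delta> where "\<delta> = 2 * K / m * e^3"
    have e: "0 < e" "e < e1" "e < e2" "e \<le> 1" "e \<le> 1 / w^2" "e \<le> m / (2 * K)"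
      using n e0' e0 by (auto simp: e_def)
    have p: "\<eta> \<le> p" "p \<le> 1 - \<eta>" "0 < p" "p < 1" using p_range eta by (auto simp: p_def)
    have x: "x < n" using p n by (auto simp: p_def field_simps)
    have e3: "e^3 \<le> e" using e power_decreasing[of 1 3 e] by simp
    have d: "0 < \<delta>" "\<delta> \<le> 1"
    proof -
      show "0 < \<delta>" using K m e by (simp add: \<delta>_def)
      have "\<delta> \<le> 2 * K / m * (m / (2 * K))" unfolding \<delta>_def using K m e e3 by (intro mult_left_mono) auto
      thus "\<delta> \<le> 1" using K m by simp
    qed
    have yw: "e * y^2 \<le> 1" if "\<bar>y\<bar> \<le> w" for y
    proof -
      have "e * y^2 \<le> 1 / w^2 * w^2" using that e w by (intro mult_mono) (simp_all add: power2_le_iff_abs_le)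
      thus ?thesis using w by simp
    qed
    note R1 = R'[OF e(1,3) p(1,2) yw]
    have cov: "\<bar>1 - binomial_cdf n x (U y) - Phi y\<bar> \<le> K * e^3" if "\<bar>y\<bar> \<le> w" for y
      using R[of n x y] n e p_range yw[OF that] by (simp add: U_def e_def p_def)
    have lip: "U b - U a \<le> 2 * e * (b - a)" if "a < b" "-w \<le> a" "b \<le> w" for a b
    proof -
      have "\<And>y. (U has_real_derivative e * sqrt (p * (1 - p)) * cf' e p y) (at y)"
        unfolding U_def by (rule DERIV_cp_approx)
      from MVT2[OF that(1) this] obtain y where y: "a < y" "y < b"
        "U b - U a = (b - a) * (e * sqrt (p * (1 - p)) * cf' e p y)" by blast
      have "cf' e p y < 2" "1/2 < cf' e p y" using R1[of y] y that by auto
      moreover have "p * (1 - p) \<le> 1 * 1" using p by (intro mult_mono) auto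
      ultimately have "e * sqrt (p * (1 - p)) * cf' e p y \<le> e * 1 * 2"
        using e p by (intro mult_mono) auto
      thus ?thesis unfolding y(3) using that by (simp add: mult.commute mult_left_mono)
    qed
    have U: "0 < U y" "U y < 1" if "\<bar>y\<bar> \<le> w" for y using R1[OF that] by (auto simp: U_def)
    note root = cp_upper_eq_binomial_cdf_root[OF x alpha]
    have md: "m * \<delta> = 2 * (K * e^3)" using m by (simp add: \<delta>_def)
    have Ke: "0 < K * e^3" using K e by simp
    have w1: "\<bar>z + \<delta>\<bar> \<le> w" "\<bar>z - \<delta>\<bar> \<le> w" "\<bar>z\<bar> \<le> w" using d by (auto simp: w_def)
    have up: "cp_upper n \<alpha> x \<le> U (z + \<delta>)"
    proof (rule ccontr)
      assume "\<not> ?thesis"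
      hence "binomial_cdf n x (cp_upper n \<alpha> x) < binomial_cdf n x (U (z + \<delta>))"
        using root U[OF w1(1)] by (intro binomial_cdf_strict_decreasing x) auto
      moreover have "m * \<delta> \<le> Phi (z + \<delta>) - Phi z"
        using Phi_diff_ge[of z "z + \<delta>" w] d w1 unfolding m_def by auto
      ultimately show False using cov[OF w1(1)] md z root(3) Ke by linarith
    qed
    have low: "U (z - \<delta>) \<le> cp_upper n \<alpha> x"
    proof (rule ccontr)
      assume "\<not> ?thesis"
      hence "binomial_cdf n x (U (z - \<delta>)) < binomial_cdf n x (cp_upper n \<alpha> x)"
        using root U[OF w1(2)] by (intro binomial_cdf_strict_decreasing x) auto
      moreover have "m * \<delta> \<le> Phi z - Phi (z - \<delta>)"
        using Phi_diff_ge[of "z - \<delta>" z w] d w1 unfolding m_def by auto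
      ultimately show False using cov[OF w1(2)] md z root(3) Ke by linarith
    qed
    have "U (z + \<delta>) - U z \<le> 2 * e * \<delta>" "U z - U (z - \<delta>) \<le> 2 * e * \<delta>"
      using lip[of z "z + \<delta>"] lip[of "z - \<delta>" z] d w1 by auto
    moreover have "2 * e * \<delta> = 4 * K / m * e^4"
      by (simp add: \<delta>_def power_numeral_reduce)
    ultimately have "\<bar>cp_upper n \<alpha> x - U z\<bar> \<le> 4 * K / m * e^4" using up low by linarith
    thus "\<bar>cp_upper n \<alpha> x - cp_approx (1 / sqrt (real n)) (real x / real n) z\<bar> \<le> 4 * K / m * (1 / sqrt (real n))^4"
      by (simp add: U_def e_def p_def)
  qed (use e0 K m in auto)
qed

section \<open>Binomial moments and the standard deviation as a function of the proportion\<close>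

lemma expectation_binomial_pmf_Suc:
  fixes f :: "nat \<Rightarrow> real"
  assumes "p \<in> {0..1}"
  shows "measure_pmf.expectation (binomial_pmf (Suc n) p) f =
    p * measure_pmf.expectation (binomial_pmf n p) (\<lambda>k. f (Suc k)) +
    (1 - p) * measure_pmf.expectation (binomial_pmf n p) f"
proof -
  have "binomial_pmf (Suc n) p = bernoulli_pmf p \<bind> (\<lambda>b. map_pmf (\<lambda>k. (if b then 1 else 0) + k) (binomial_pmf n p))"
    unfolding binomial_pmf_Suc[OF assms] by (simp add: map_pmf_def)
  also have "measure_pmf.expectation \<dots> f = (\<Sum>b\<in>UNIV. pmf (bernoulli_pmf p) b *\<^sub>R
      measure_pmf.expectation (map_pmf (\<lambda>k. (if b then 1 else 0) + k) (binomial_pmf n p)) f)"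
    by (rule pmf_expectation_bind) (use finite_set_pmf_binomial_pmf[OF assms] in auto)
  finally show ?thesis using assms by (simp add: UNIV_bool)
qed

text \<open>Induction on the number of trials. For j = 4 the third moment drops out, since one trial
  is centred, and the increment is at most 2 n + 1 = (n + 1)^2 - n^2.\<close>

lemma binomial_central_moments:
  assumes p: "p \<in> {0..1}"
  defines "M \<equiv> \<lambda>n j. measure_pmf.expectation (binomial_pmf n p) (\<lambda>k. (real k - real n * p) ^ j)"
  shows "M n 1 = 0" "M n 2 = real n * (p * (1 - p))" "M n 4 \<le> (real n)^2"
proof -
  have shift: "measure_pmf.expectation (binomial_pmf n p) (\<lambda>k. (real k - real n * p + c) ^ j)
      = (\<Sum>i\<le>j. real (j choose i) * M n i * c ^ (j - i))" for n c j
    unfolding binomial_ring M_def using p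
    by (subst Bochner_Integration.integral_sum) (auto simp: integrable_binomial_pmf)
  have step: "M (Suc n) j = p * (\<Sum>i\<le>j. real (j choose i) * M n i * (1 - p) ^ (j - i))
     + (1 - p) * (\<Sum>i\<le>j. real (j choose i) * M n i * (- p) ^ (j - i))" for n j
  proof -
    have "real (Suc k) - real (Suc n) * p = real k - real n * p + (1 - p)"
      "real k - real (Suc n) * p = real k - real n * p + (- p)" for k
      by (simp_all add: algebra_simps)
    thus ?thesis unfolding shift[symmetric] unfolding M_def expectation_binomial_pmf_Suc[OF p] by (simp only:)
  qed
  have M0: "M n 0 = 1" for n by (simp add: M_def)
  have init: "M 0 j = 0" if "j > 0" for j
    using that by (simp add: M_def binomial_pmf_0[OF p])
  have M1: "M n 1 = 0" for n
  proof (induction n)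
    case (Suc n)
    thus ?case unfolding step by (simp add: M0 algebra_simps)
  qed (simp add: init)
  have M2: "M n 2 = real n * (p * (1 - p))" for n
  proof (induction n)
    case (Suc n)
    have "M (Suc n) 2 = M n 2 + p * (1 - p)^2 + (1 - p) * p^2"
      unfolding step using M1[of n] by (simp add: M0 numeral_2_eq_2 algebra_simps)
    also have "\<dots> = real (Suc n) * (p * (1 - p))"
      unfolding Suc by (simp add: algebra_simps power2_eq_square)
    finally show ?case .
  qed (simp add: init)
  have M4: "M n 4 \<le> (real n)^2" for n
  proof (induction n)
    case (Suc n)
    have pq: "0 \<le> p * (1 - p)" "p * (1 - p) \<le> 1/4"
      using p zero_le_power2[of "p - 1/2"]
      by (simp, simp add: power2_eq_square algebra_simps)
    have "M (Suc n) 4 = M n 4 + 6 * M n 2 * (p * (1 - p)) + p * (1 - p)^4 + (1 - p) * p^4"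
      unfolding step using M1[of n]
      by (simp add: M0 eval_nat_numeral algebra_simps)
    also have "6 * M n 2 * (p * (1 - p)) = real n * (6 * (p * (1 - p))^2)"
      unfolding M2 by (simp add: power2_eq_square)
    also have "\<dots> \<le> real n * 2"
    proof (rule mult_left_mono)
      have "(p * (1 - p))^2 \<le> (1/4)^2" using pq by (intro power_mono) auto
      also have "(1/4::real)^2 = 1/16" by (simp add: power2_eq_square)
      finally show "6 * (p * (1 - p))^2 \<le> 2" by simp
    qed simp
    also have "p * (1 - p)^4 \<le> p * 1" using p by (intro mult_left_mono power_le_one) auto
    also have "(1 - p) * p^4 \<le> (1 - p) * 1" using p by (intro mult_left_mono power_le_one) auto
    finally show ?case using Suc by (simp add: power2_eq_square algebra_simps)
  qed (simp add: init)
  show "M n 1 = 0" "M n 2 = real n * (p * (1 - p))" "M n 4 \<le> (real n)^2"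
    by (fact M1 M2 M4)+
qed

lemma binomial_proportion_moments:
  assumes p: "p \<in> {0..1}" and n: "0 < n"
  shows "measure_pmf.expectation (binomial_pmf n p) (\<lambda>k. real k / real n - p) = 0"
    and "measure_pmf.expectation (binomial_pmf n p) (\<lambda>k. (real k / real n - p)^2) = p * (1 - p) / real n"
    and "measure_pmf.expectation (binomial_pmf n p) (\<lambda>k. (real k / real n - p)^4) \<le> 1 / (real n)^2"
proof -
  have "real k / real n - p = (real k - real n * p) / real n" for k
    using n by (simp add: field_simps)
  hence eq: "measure_pmf.expectation (binomial_pmf n p) (\<lambda>k. (real k / real n - p)^j)
      = measure_pmf.expectation (binomial_pmf n p) (\<lambda>k. (real k - real n * p) ^ j) / (real n)^j" for j
    by (simp add: power_divide)
  show "measure_pmf.expectation (binomial_pmf n p) (\<lambda>k. real k / real n - p) = 0"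
    using eq[of 1] binomial_central_moments(1)[OF p, of n] by simp
  show "measure_pmf.expectation (binomial_pmf n p) (\<lambda>k. (real k / real n - p)^2) = p * (1 - p) / real n"
    unfolding eq binomial_central_moments(2)[OF p] using n by (simp add: power2_eq_square)
  show "measure_pmf.expectation (binomial_pmf n p) (\<lambda>k. (real k / real n - p)^4) \<le> 1 / (real n)^2"
  proof -
    have "measure_pmf.expectation (binomial_pmf n p) (\<lambda>k. (real k - real n * p) ^ 4) / (real n)^4 \<le> (real n)^2 / (real n)^4"
      by (intro divide_right_mono binomial_central_moments(3)[OF p]) auto
    also have "\<dots> = 1 / (real n)^2" using n by (simp add: power_numeral_reduce)
    finally show ?thesis unfolding eq .
  qed
qed

text \<open>In terms of r = sqrt (1 + y) the remainder is exactly (r - 1)^3 (r + 3) / 8, while y =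
  (r - 1) (r + 1). No smallness of y is required, so the expansion below holds on all of
  [0,1].\<close>

lemma sqrt_taylor2: 
  assumes "-1 \<le> y" shows "\<bar>sqrt (1 + y) - (1 + y / 2 - y^2 / 8)\<bar> \<le> \<bar>y\<bar> ^ 3"
proof -
  define r where "r = sqrt (1 + y)"
  have r: "0 \<le> r" "y = r^2 - 1" using assms by (auto simp: r_def)
  have "sqrt (1 + y) - (1 + y / 2 - y^2 / 8) = (r - 1)^3 * ((r + 3) / 8)"
    unfolding r_def[symmetric] unfolding r(2) by (simp add: field_simps) algebra
  hence "\<bar>sqrt (1 + y) - (1 + y / 2 - y^2 / 8)\<bar> = \<bar>(r - 1)^3 * ((r + 3) / 8)\<bar>" by (simp only:)
  also have "\<dots> = \<bar>r - 1\<bar>^3 * ((r + 3) / 8)"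
    using r(1) by (simp add: abs_mult power_abs)
  also have "\<dots> \<le> \<bar>r - 1\<bar>^3 * (r + 1)^3"
  proof (rule mult_left_mono)
    have "(r + 3) / 8 \<le> 1 + 3 * r" using r by simp
    also have "\<dots> \<le> (r + 1)^3" using r by (simp add: power3_eq_cube algebra_simps)
    finally show "(r + 3) / 8 \<le> (r + 1)^3" .
  qed simp
  also have "\<dots> = \<bar>y\<bar>^3"
  proof -
    have "\<bar>y\<bar> = \<bar>r - 1\<bar> * (r + 1)"
    proof -
      have "y = (r - 1) * (r + 1)" unfolding r(2) by algebra
      thus ?thesis using r(1) by (simp add: abs_mult)
    qed
    thus ?thesis by (simp add: power_mult_distrib)
  qed
  finally show ?thesis .
qed

lemma sqrt_variance_expansion:
  assumes p: "0 < p" "p < 1"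
  obtains K where "0 < K" "\<And>x. 0 \<le> x \<Longrightarrow> x \<le> 1 \<Longrightarrow>
    \<bar>sqrt (x * (1 - x)) - (sqrt (p * (1 - p)) + (1 - 2 * p) * (x - p) / (2 * sqrt (p * (1 - p)))
       - (x - p)^2 / (8 * sqrt (p * (1 - p)) ^ 3))\<bar> \<le> K * \<bar>x - p\<bar> ^ 3"
proof -
  define s where "s = sqrt (p * (1 - p))"
  have s: "0 < s" "s^2 = p * (1 - p)" using p by (auto simp: s_def)
  define K where "K = s * ((2 / s^2)^3 + 3 / (8 * s^4))"
  show thesis
  proof (rule that[of K])
    show "0 < K" using s(1) by (simp add: K_def add_pos_pos)
    fix x :: real assume x: "0 \<le> x" "x \<le> 1"
    define d where "d = x - p"
    have d: "\<bar>d\<bar> \<le> 1" using x p by (auto simp: d_def)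
    \<comment> \<open>Chosen so that x (1 - x) = s^2 (1 + y). The two contributions to d^2 then
      combine through 4 s^2 + (1 - 2 p)^2 = 1.\<close>
    define y where "y = ((1 - 2 * p) * d - d^2) / s^2"
    have y: "s^2 * (1 + y) = x * (1 - x)"
    proof -
      have "s^2 * (1 + y) = s^2 + ((1 - 2 * p) * d - d^2)" using s(1) by (simp add: y_def distrib_left)
      also have "\<dots> = x * (1 - x)" unfolding s(2) d_def by algebra
      finally show ?thesis .
    qed
    have y1: "-1 \<le> y"
    proof -
      have "0 \<le> s^2 * (1 + y)" unfolding y using x by simp
      thus ?thesis using s(1) by (simp add: zero_le_mult_iff)
    qed
    have root: "sqrt (x * (1 - x)) = s * sqrt (1 + y)"
      unfolding y[symmetric] using s(1) by (simp add: real_sqrt_mult)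
    have ya: "\<bar>y\<bar> \<le> 2 / s^2 * \<bar>d\<bar>"
    proof -
      have "\<bar>(1 - 2 * p) * d - d^2\<bar> = \<bar>1 - 2 * p - d\<bar> * \<bar>d\<bar>"
        by (simp add: algebra_simps power2_eq_square flip: abs_mult)
      also have "\<dots> \<le> 2 * \<bar>d\<bar>" using p d by (intro mult_right_mono) auto
      finally show ?thesis using s(1) by (simp add: y_def abs_divide divide_right_mono)
    qed
    have "1 + y / 2 - y^2 / 8 = 1 + (1 - 2 * p) * d / (2 * s^2) - d^2 / (8 * s^4)
        + (2 * (1 - 2 * p) - d) * d^3 / (8 * s^4)"
    proof -
      have "s^4 = (s^2)^2" by simp
      have id: "4 * s^2 + (1 - 2 * p)^2 = 1" unfolding s(2) by algebra
      have "8 * s^4 * (1 + y / 2 - y^2 / 8) = 8 * s^4 + 4 * s^2 * (s^2 * y) - (s^2 * y)^2"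
        by (simp add: algebra_simps power_mult_distrib flip: power_mult power_add)
      also have "s^2 * y = (1 - 2 * p) * d - d^2" using s(1) by (simp add: y_def)
      also have "8 * s^4 + 4 * s^2 * ((1 - 2 * p) * d - d^2) - ((1 - 2 * p) * d - d^2)^2
         = 8 * s^4 + 4 * s^2 * ((1 - 2 * p) * d) - (4 * s^2 + (1 - 2 * p)^2) * d^2 + (2 * (1 - 2 * p) - d) * d^3"
        by algebra
      also have "\<dots> = 8 * s^4 * (1 + (1 - 2 * p) * d / (2 * s^2) - d^2 / (8 * s^4)
        + (2 * (1 - 2 * p) - d) * d^3 / (8 * s^4))"
        unfolding id using s(1) by (simp add: field_simps power_numeral_reduce)
      finally show ?thesis using s(1) by simp
    qed
    hence "sqrt (1 + y) - (1 + (1 - 2 * p) * d / (2 * s^2) - d^2 / (8 * s^4))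
       = (sqrt (1 + y) - (1 + y / 2 - y^2 / 8)) + (2 * (1 - 2 * p) - d) * d^3 / (8 * s^4)" by simp
    also have "\<bar>\<dots>\<bar> \<le> \<bar>y\<bar>^3 + 3 / (8 * s^4) * \<bar>d\<bar>^3"
    proof (rule order_trans[OF abs_triangle_ineq add_mono])
      show "\<bar>sqrt (1 + y) - (1 + y / 2 - y^2 / 8)\<bar> \<le> \<bar>y\<bar>^3" by (rule sqrt_taylor2[OF y1])
      have "\<bar>(2 * (1 - 2 * p) - d) * d^3\<bar> = \<bar>2 * (1 - 2 * p) - d\<bar> * \<bar>d\<bar>^3"
        by (simp add: abs_mult power_abs)
      also have "\<dots> \<le> 3 * \<bar>d\<bar>^3" using p d by (intro mult_right_mono) auto
      finally show "\<bar>(2 * (1 - 2 * p) - d) * d^3 / (8 * s^4)\<bar> \<le> 3 / (8 * s^4) * \<bar>d\<bar>^3"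
        using s(1) by (simp add: abs_divide divide_right_mono)
    qed
    also have "\<bar>y\<bar>^3 \<le> (2 / s^2 * \<bar>d\<bar>)^3" using ya by (intro power_mono) auto
    also have "(2 / s^2 * \<bar>d\<bar>)^3 + 3 / (8 * s^4) * \<bar>d\<bar>^3 = ((2 / s^2)^3 + 3 / (8 * s^4)) * \<bar>d\<bar>^3"
      unfolding power_mult_distrib by (simp only: distrib_right)
    finally have *: "s * \<bar>sqrt (1 + y) - (1 + (1 - 2 * p) * d / (2 * s^2) - d^2 / (8 * s^4))\<bar> \<le> K * \<bar>d\<bar>^3"
      using s(1) by (simp add: K_def mult.assoc)
    have "sqrt (x * (1 - x)) - (s + (1 - 2 * p) * d / (2 * s) - d^2 / (8 * s^3))
        = s * (sqrt (1 + y) - (1 + (1 - 2 * p) * d / (2 * s^2) - d^2 / (8 * s^4)))"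
    proof -
      have "s * (A / (2 * s^2)) = A / (2 * s)" "s * (B / (8 * s^4)) = B / (8 * s^3)" for A B
        using s(1) by (simp_all add: power_numeral_reduce)
      thus ?thesis unfolding root unfolding right_diff_distrib distrib_left by simp
    qed
    with * show "\<bar>sqrt (x * (1 - x)) - (sqrt (p * (1 - p)) + (1 - 2 * p) * (x - p) / (2 * sqrt (p * (1 - p)))
       - (x - p)^2 / (8 * sqrt (p * (1 - p)) ^ 3))\<bar> \<le> K * \<bar>x - p\<bar> ^ 3"
      using s(1) unfolding s_def[symmetric] d_def[symmetric] by (simp add: abs_mult)
  qed
qed

section \<open>Expansion of the expected length\<close>

text \<open>Equal to \<open>sqrt (x * (1 - x)) * cf1 x z\<close>: the square root cancels and leaves
  a function affine in x, whose first-order expansion is exact.\<close>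

definition cp_center :: "real \<Rightarrow> real \<Rightarrow> real" where
  "cp_center z x = ((1 - 2 * x) * z^2 + 2 - x) / 3"

definition cp_third :: "real \<Rightarrow> real \<Rightarrow> real" where
  "cp_third z x = sqrt (x * (1 - x)) * cf2 x z"

lemma cp_approx_eq:
  assumes "0 < x" "x < 1"
  shows "cp_approx e x z = x + e * z * sqrt (x * (1 - x)) + e^2 * cp_center z x + e^3 * cp_third z x"
proof -
  have "sqrt (x * (1 - x)) * cf1 x z = cp_center z x"
    using assms by (simp add: cf1_def cp_center_def)
  hence "e^2 * (sqrt (x * (1 - x)) * cf1 x z) = e^2 * cp_center z x" by simp
  thus ?thesis unfolding cp_approx_def cf_def cp_third_def
    by (simp add: algebra_simps power_numeral_reduce)
qed

lemma cp_third_lipschitz: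
  assumes "0 < \<eta>"
  obtains K where "0 < K" "\<And>x y. \<eta> \<le> x \<Longrightarrow> x \<le> 1 - \<eta> \<Longrightarrow> \<eta> \<le> y \<Longrightarrow> y \<le> 1 - \<eta> \<Longrightarrow>
    \<bar>cp_third z x - cp_third z y\<bar> \<le> K * \<bar>x - y\<bar>"
proof -
  \<comment> \<open>Written in the shape that the product and quotient rules produce; only its
    continuity on the compact interval matters afterwards.\<close>
  define f' where "f' = (\<lambda>x. (1 - 2 * x) / (2 * sqrt (x * (1 - x))) * cf2 x z
     + ((z * (18 - 72 * x) * (36 * (x * (1 - x))) - z * (z^2 + 11 + 18 * x * (1 - 2 * x)) * (36 * (1 - 2 * x)))
         / (36 * (x * (1 - x)) * (36 * (x * (1 - x)))) - 0) * sqrt (x * (1 - x)))"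
  have der: "(cp_third z has_real_derivative f' x) (at x)" if x: "0 < x" "x < 1" for x
  proof -
    have "((\<lambda>x. sqrt (x * (1 - x))) has_real_derivative (1 - 2 * x) / (2 * sqrt (x * (1 - x)))) (at x)"
      using x by (auto intro!: derivative_eq_intros simp: field_simps)
    moreover have "((\<lambda>x. cf2 x z) has_real_derivative
        (z * (18 - 72 * x) * (36 * (x * (1 - x))) - z * (z^2 + 11 + 18 * x * (1 - 2 * x)) * (36 * (1 - 2 * x)))
         / (36 * (x * (1 - x)) * (36 * (x * (1 - x)))) - 0) (at x)"
      unfolding cf2_def
    proof (intro DERIV_diff DERIV_divide DERIV_const)
      show "((\<lambda>x. z * (z^2 + 11 + 18 * x * (1 - 2 * x))) has_real_derivative z * (18 - 72 * x)) (at x)"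
        by (auto intro!: derivative_eq_intros simp: algebra_simps)
      show "((\<lambda>x. 36 * (x * (1 - x))) has_real_derivative 36 * (1 - 2 * x)) (at x)"
        by (auto intro!: derivative_eq_intros simp: algebra_simps)
    qed (use x in auto)
    ultimately show ?thesis
      unfolding cp_third_def[abs_def] f'_def by (rule DERIV_mult)
  qed
  have "continuous_on {\<eta>..1 - \<eta>} f'"
    unfolding f'_def cf2_def using assms by (intro continuous_intros) auto
  hence "bounded (f' ` {\<eta>..1 - \<eta>})"
    by (intro compact_imp_bounded compact_continuous_image) auto
  then obtain K where K: "0 < K" "\<And>x. x \<in> {\<eta>..1 - \<eta>} \<Longrightarrow> \<bar>f' x\<bar> \<le> K"
    by (auto simp: bounded_pos)
  show thesis
  proof (rule that[OF K(1)])
    fix x y assume xy: "\<eta> \<le> x" "x \<le> 1 - \<eta>" "\<eta> \<le> y" "y \<le> 1 - \<eta>"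
    have "norm (cp_third z x - cp_third z y) \<le> K * norm (x - y)"
    proof (rule field_differentiable_bound[where S = "{\<eta>..1 - \<eta>}"])
      fix u assume "u \<in> {\<eta>..1 - \<eta>}"
      thus "(cp_third z has_real_derivative f' u) (at u within {\<eta>..1 - \<eta>})"
        using assms by (intro DERIV_subset[OF der]) auto
    qed (use K xy in auto)
    thus "\<bar>cp_third z x - cp_third z y\<bar> \<le> K * \<bar>x - y\<bar>" by simp
  qed
qed

text \<open>Expansion in d = x / n - p of total degree 3 in (e, d): second order in the term with e,
  first order with e^2, order zero with e^3. The factor (2 z^2 + 1) / 3 is minus the slope of
  \<open>cp_center\<close>.\<close>

definition cp_taylor :: "real \<Rightarrow> real \<Rightarrow> real \<Rightarrow> real \<Rightarrow> real" where
  "cp_taylor e z p d = d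
     + e * z * (sqrt (p * (1 - p)) + (1 - 2 * p) * d / (2 * sqrt (p * (1 - p))) - d^2 / (8 * sqrt (p * (1 - p)) ^ 3))
     + e^2 * (cp_center z p - (2 * z^2 + 1) / 3 * d)
     + e^3 * cp_third z p"

lemma cp_upper_bounds:
  assumes "0 < \<alpha>" "\<alpha> < 1"
  shows "0 \<le> cp_upper n \<alpha> x" "cp_upper n \<alpha> x \<le> 1"
proof -
  have "0 \<le> cp_upper n \<alpha> x \<and> cp_upper n \<alpha> x \<le> 1"
  proof (cases "x < n")
    case True
    thus ?thesis using cp_upper_eq_binomial_cdf_root(1,2)[OF True assms] by auto
  next
    case False
    thus ?thesis by (simp add: cp_upper_def)
  qed
  thus "0 \<le> cp_upper n \<alpha> x" "cp_upper n \<alpha> x \<le> 1" by auto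
qed

text \<open>The error is stated with even powers of d so that the second and fourth binomial moments
  suffice later, and for every x \<le> n, so that no event has to be split off in the
  expectation.\<close>

lemma cp_upper_length_taylor:
  assumes p: "0 < p" "p < 1" and alpha: "0 < \<alpha>" "\<alpha> < 1" and z: "Phi z = 1 - \<alpha>"
  obtains K e0 :: real where "0 < e0" "0 < K"
    "\<And>n x. 0 < n \<Longrightarrow> 1 / sqrt (real n) < e0 \<Longrightarrow> x \<le> n \<Longrightarrow>
      \<bar>cp_upper_length n \<alpha> p x - cp_taylor (1 / sqrt (real n)) z p (real x / real n - p)\<bar>
       \<le> K * ((1 / sqrt (real n))^4 + (1 / sqrt (real n))^2 * (real x / real n - p)^2 + (real x / real n - p)^4)"
proof -
  define s where "s = sqrt (p * (1 - p))"
  \<comment> \<open>Half the distance from p to the boundary: |d| \<le> \<eta> keeps both x / n and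
    p in [\<eta>, 1 - \<eta>].\<close>
  define \<eta> where "\<eta> = min p (1 - p) / 2"
  have eta: "0 < \<eta>" "\<eta> \<le> p / 2" "\<eta> \<le> (1 - p) / 2" using p by (auto simp: \<eta>_def)
  have s: "0 < s" using p by (simp add: s_def)
  obtain K1 e1 where K1: "0 < e1" "0 < K1" and R1:
    "\<And>n x. 0 < n \<Longrightarrow> 1 / sqrt (real n) < e1 \<Longrightarrow> \<eta> \<le> real x / real n \<Longrightarrow> real x / real n \<le> 1 - \<eta> \<Longrightarrow>
      \<bar>cp_upper n \<alpha> x - cp_approx (1 / sqrt (real n)) (real x / real n) z\<bar> \<le> K1 * (1 / sqrt (real n))^4"
    by (rule cp_upper_expansion[OF eta(1) alpha z]) (rule that; assumption)
  obtain K2 where K2: "0 < K2" and R2: "\<And>x. 0 \<le> x \<Longrightarrow> x \<le> 1 \<Longrightarrow>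
    \<bar>sqrt (x * (1 - x)) - (sqrt (p * (1 - p)) + (1 - 2 * p) * (x - p) / (2 * sqrt (p * (1 - p)))
       - (x - p)^2 / (8 * sqrt (p * (1 - p)) ^ 3))\<bar> \<le> K2 * \<bar>x - p\<bar> ^ 3"
    by (rule sqrt_variance_expansion[OF p]) (rule that; assumption)
  obtain K3 where K3: "0 < K3" and R3: "\<And>x y. \<eta> \<le> x \<Longrightarrow> x \<le> 1 - \<eta> \<Longrightarrow> \<eta> \<le> y \<Longrightarrow> y \<le> 1 - \<eta> \<Longrightarrow>
    \<bar>cp_third z x - cp_third z y\<bar> \<le> K3 * \<bar>x - y\<bar>"
    by (rule cp_third_lipschitz[OF eta(1), of z]) (rule that; assumption)
  define B where "B = \<bar>z\<bar> * (s + 1 / (2 * s) + 1 / (8 * s^3)) + (\<bar>cp_center z p\<bar> + (2 * z^2 + 1) / 3) + \<bar>cp_third z p\<bar>"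
  define K where "K = K1 + \<bar>z\<bar> * K2 + K3 + (2 + B) / \<eta>^4"
  have B: "0 \<le> B" using s by (simp add: B_def)
  have K: "0 < K" using K1 K2 K3 B eta by (simp add: K_def add_pos_nonneg)
  show thesis
  proof (rule that[of "min e1 1" K])
    fix n x :: nat
    assume n: "0 < n" and e0: "1 / sqrt (real n) < min e1 1" and x: "x \<le> n"
    define e where "e = 1 / sqrt (real n)"
    define r where "r = real x / real n"
    define d where "d = r - p"
    have e: "0 < e" "e < e1" "e < 1" using n e0 by (auto simp: e_def)
    have r: "0 \<le> r" "r \<le> 1" using n x by (auto simp: r_def)
    have d: "\<bar>d\<bar> \<le> 1" using r p by (auto simp: d_def)
    define Q where "Q = e^4 + e^2 * d^2 + d^4"
    have Q: "e^4 \<le> Q" "d^4 \<le> Q" "0 \<le> Q" by (simp_all add: Q_def)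
    have "\<bar>cp_upper n \<alpha> x - p - cp_taylor e z p d\<bar> \<le> K * Q"
    proof (cases "\<bar>d\<bar> \<le> \<eta>")
      case True
      hence rr: "\<eta> \<le> r" "r \<le> 1 - \<eta>" "0 < r" "r < 1" using eta by (auto simp: d_def)
      have pp: "\<eta> \<le> p" "p \<le> 1 - \<eta>" using eta by auto
      define D1 where "D1 = sqrt (r * (1 - r)) - (s + (1 - 2 * p) * d / (2 * s) - d^2 / (8 * s^3))"
      have D1: "\<bar>D1\<bar> \<le> K2 * \<bar>d\<bar>^3" using R2[OF r] by (simp add: D1_def s_def d_def)
      have D3: "\<bar>cp_third z r - cp_third z p\<bar> \<le> K3 * \<bar>d\<bar>" using R3[OF rr(1,2) pp] by (simp add: d_def)
      have center: "cp_center z r = cp_center z p - (2 * z^2 + 1) / 3 * d"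
        by (simp add: cp_center_def d_def field_simps)
      have "cp_approx e r z - p - cp_taylor e z p d = e * z * D1 + e^3 * (cp_third z r - cp_third z p)"
        unfolding cp_approx_eq[OF rr(3,4)] cp_taylor_def center D1_def s_def
        by (simp add: d_def algebra_simps)
      also have "\<bar>\<dots>\<bar> \<le> e * \<bar>z\<bar> * (K2 * \<bar>d\<bar>^3) + e^3 * (K3 * \<bar>d\<bar>)"
        using D1 D3 e by (intro order_trans[OF abs_triangle_ineq] add_mono) (auto simp: abs_mult intro!: mult_left_mono)
      also have "\<dots> = \<bar>z\<bar> * K2 * (e * \<bar>d\<bar>^3) + K3 * (e^3 * \<bar>d\<bar>)" by (simp add: mult_ac)
      also have "\<dots> \<le> \<bar>z\<bar> * K2 * Q + K3 * Q"
      proof (intro add_mono mult_left_mono)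
        \<comment> \<open>The mixed terms e |d|^3 and e^3 |d| are absorbed by the
          arithmetic-geometric mean inequality.\<close>
        have "0 \<le> (e * \<bar>d\<bar> - d^2)^2" "0 \<le> (e^2 - e * \<bar>d\<bar>)^2" by simp_all
        moreover have "(e * \<bar>d\<bar> - d^2)^2 = e^2 * d^2 + d^4 - 2 * (e * \<bar>d\<bar>^3)"
          "(e^2 - e * \<bar>d\<bar>)^2 = e^4 + e^2 * d^2 - 2 * (e^3 * \<bar>d\<bar>)"
          by (cases "0 \<le> d"; simp add: power2_eq_square algebra_simps power_numeral_reduce)+
        moreover have "0 \<le> e^4" "0 \<le> e^2 * d^2" "0 \<le> d^4" by simp_all
        ultimately show "e * \<bar>d\<bar>^3 \<le> Q" "e^3 * \<bar>d\<bar> \<le> Q" unfolding Q_def by linarith+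
      qed (use K2 K3 in auto)
      finally have 1: "\<bar>cp_approx e r z - p - cp_taylor e z p d\<bar> \<le> \<bar>z\<bar> * K2 * Q + K3 * Q" .
      have "\<bar>cp_upper n \<alpha> x - cp_approx e r z\<bar> \<le> K1 * e^4"
        using R1[of n x] n e rr by (simp add: e_def r_def)
      also have "\<dots> \<le> K1 * Q" using K1 Q by simp
      finally have "\<bar>cp_upper n \<alpha> x - p - cp_taylor e z p d\<bar> \<le> (K1 + \<bar>z\<bar> * K2 + K3) * Q"
        using 1 by (simp add: algebra_simps)
      also have "\<dots> \<le> K * Q" using B eta Q by (intro mult_right_mono) (auto simp: K_def)
      finally show ?thesis .
    next
      \<comment> \<open>Far from p, including x = 0 and x = n, nothing is expanded: both quantities
        are bounded, and a constant is at most a multiple of d^4 because |d| > \<eta>.\<close>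
      case False
      have e1: "e \<le> 1" "e^2 \<le> 1" "e^3 \<le> 1" using e by (auto intro: power_le_one)
      have d1: "\<bar>d\<bar> \<le> 1" "d^2 \<le> 1" using d by (auto simp: abs_square_le_1)
      have "\<bar>cp_taylor e z p d\<bar> \<le> 1 + B"
      proof -
        have a1: "\<bar>(1 - 2 * p) * d / (2 * s)\<bar> \<le> 1 / (2 * s)"
        proof -
          have "\<bar>1 - 2 * p\<bar> * \<bar>d\<bar> \<le> 1 * 1" using p d by (intro mult_mono) auto
          thus ?thesis using s by (simp add: abs_mult divide_right_mono)
        qed
        have a2: "\<bar>d^2 / (8 * s^3)\<bar> \<le> 1 / (8 * s^3)" using s d1 by (simp add: divide_right_mono)
        have b1: "\<bar>e * z * (s + (1 - 2 * p) * d / (2 * s) - d^2 / (8 * s^3))\<bar>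
            \<le> \<bar>z\<bar> * (s + 1 / (2 * s) + 1 / (8 * s^3))"
        proof -
          have "\<bar>s + (1 - 2 * p) * d / (2 * s) - d^2 / (8 * s^3)\<bar> \<le> s + 1 / (2 * s) + 1 / (8 * s^3)"
            using a1 a2 s by linarith
          moreover have "\<bar>e * z\<bar> \<le> \<bar>z\<bar>" using e by (simp add: abs_mult mult_left_le_one_le)
          ultimately show ?thesis unfolding abs_mult[of "e * z"] by (intro mult_mono) auto
        qed
        have b2: "\<bar>e^2 * (cp_center z p - (2 * z^2 + 1) / 3 * d)\<bar> \<le> \<bar>cp_center z p\<bar> + (2 * z^2 + 1) / 3"
        proof -
          have "\<bar>(2 * z^2 + 1) / 3 * d\<bar> \<le> (2 * z^2 + 1) / 3"
            using d1 by (simp add: abs_mult mult_left_le)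
          hence "\<bar>cp_center z p - (2 * z^2 + 1) / 3 * d\<bar> \<le> \<bar>cp_center z p\<bar> + (2 * z^2 + 1) / 3" by linarith
          moreover have "\<bar>e^2 * y\<bar> \<le> \<bar>y\<bar>" for y using e1 by (simp add: abs_mult mult_left_le_one_le)
          ultimately show ?thesis by (meson order_trans)
        qed
        have b3: "\<bar>e^3 * cp_third z p\<bar> \<le> \<bar>cp_third z p\<bar>"
          using e1 e by (simp add: abs_mult mult_left_le_one_le)
        show ?thesis unfolding cp_taylor_def B_def s_def[symmetric] using b1 b2 b3 d1 by linarith
      qed
      hence "\<bar>cp_upper n \<alpha> x - p - cp_taylor e z p d\<bar> \<le> 2 + B"
        using cp_upper_bounds[OF alpha, of n x] p by linarith
      also have "\<dots> \<le> (2 + B) / \<eta>^4 * d^4"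
      proof -
        have "\<eta>^4 \<le> \<bar>d\<bar>^4" using False eta by (intro power_mono) auto
        hence "(2 + B) * \<eta>^4 \<le> (2 + B) * d^4" using B by (intro mult_left_mono) auto
        thus ?thesis using eta by (simp add: field_simps)
      qed
      also have "\<dots> \<le> K * Q" using B eta Q K1 K2 K3 by (intro mult_mono) (auto simp: K_def)
      finally show ?thesis .
    qed
    thus "\<bar>cp_upper_length n \<alpha> p x - cp_taylor (1 / sqrt (real n)) z p (real x / real n - p)\<bar>
       \<le> K * ((1 / sqrt (real n))^4 + (1 / sqrt (real n))^2 * (real x / real n - p)^2 + (real x / real n - p)^4)"
      by (simp add: cp_upper_length_def Q_def e_def d_def r_def)
  qed (use K K1 in auto)
qed

text \<open>In d the polynomial is quadratic: the linear part has mean zero, and the mean s^2 e^2 of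
  d^2 moves the curvature term from order e to order e^3.\<close>

lemma expectation_cp_taylor:
  assumes p: "0 < p" "p < 1" and n: "0 < n"
  defines "e \<equiv> 1 / sqrt (real n)" and "s \<equiv> sqrt (p * (1 - p))"
  shows "measure_pmf.expectation (binomial_pmf n p) (\<lambda>k. cp_taylor e z p (real k / real n - p))
    = e * z * s + e^2 * cp_center z p + e^3 * (cp_third z p - z / (8 * s))"
proof -
  have p': "p \<in> {0..1}" using p by auto
  have s: "0 < s" "s^2 = p * (1 - p)" using p by (auto simp: s_def)
  define a b where "a = 1 + e * z * ((1 - 2 * p) / (2 * s)) - e^2 * ((2 * z^2 + 1) / 3)"
    and "b = e * z / (8 * s^3)"
  define c where "c = e * z * s + e^2 * cp_center z p + e^3 * cp_third z p"
  have "cp_taylor e z p d = a * d - b * d^2 + c" for d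
    unfolding cp_taylor_def a_def b_def c_def s_def[symmetric] by (simp add: algebra_simps)
  hence "measure_pmf.expectation (binomial_pmf n p) (\<lambda>k. cp_taylor e z p (real k / real n - p))
     = a * measure_pmf.expectation (binomial_pmf n p) (\<lambda>k. real k / real n - p)
       - b * measure_pmf.expectation (binomial_pmf n p) (\<lambda>k. (real k / real n - p)^2) + c"
    using p' by simp
  also have "\<dots> = c - b * (s^2 * e^2)"
    unfolding binomial_proportion_moments(1,2)[OF p' n] using n by (simp add: s(2) e_def power_divide)
  also have "b * (s^2 * e^2) = e^3 * (z / (8 * s))"
    using s(1) by (simp add: b_def power_numeral_reduce)
  finally show ?thesis by (simp add: c_def algebra_simps)
qed

theorem theorem3:
  fixes p q \<alpha> z :: real
  assumes "0 < p" and "p < 1"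
    and "0 < \<alpha>" and "\<alpha> < 1"
    and "q = 1 - p"
    and "z = std_normal_upper_quantile \<alpha>"
  shows "(\<lambda>n::nat.
            measure_pmf.expectation (binomial_pmf n p) (cp_upper_length n \<alpha> p)
            - (real n powr (-1/2) * z * (p * q) powr (1/2)
               + 1 / (3 * real n) * (2 * (1/2 - p) * z\<^sup>2 + 1 + q)
               + real n powr (-3/2) * z * (p * q) powr (1/2)
                 * (- 53/36 + (1/2 - p) / q + (z\<^sup>2 + 13/2) / (36 * p * q)
                    - 13 * z\<^sup>2 / 36)))
         \<in> O(\<lambda>n. real n powr (-2))"
proof -
  note p = assms(1,2) and alpha = assms(3,4)
  have p': "p \<in> {0..1}" using p by auto
  have z: "Phi z = 1 - \<alpha>"
    unfolding assms(6) std_normal_upper_quantile_def by (rule Phi_upper_quantile[OF alpha])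
  obtain K e0 where K: "0 < e0" "0 < K" and R:
    "\<And>n x. 0 < n \<Longrightarrow> 1 / sqrt (real n) < e0 \<Longrightarrow> x \<le> n \<Longrightarrow>
      \<bar>cp_upper_length n \<alpha> p x - cp_taylor (1 / sqrt (real n)) z p (real x / real n - p)\<bar>
       \<le> K * ((1 / sqrt (real n))^4 + (1 / sqrt (real n))^2 * (real x / real n - p)^2 + (real x / real n - p)^4)"
    by (rule cp_upper_length_taylor[OF p alpha z]) (rule that; assumption)
  have lim: "((\<lambda>n. 1 / sqrt (real n)) \<longlongrightarrow> 0) sequentially" by real_asymp
  have "eventually (\<lambda>n. 1 / sqrt (real n) < e0) sequentially"
    by (rule order_tendstoD(2)[OF lim K(1)])
  hence "eventually (\<lambda>n. norm (measure_pmf.expectation (binomial_pmf n p) (cp_upper_length n \<alpha> p)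
            - (real n powr (-1/2) * z * (p * q) powr (1/2)
               + 1 / (3 * real n) * (2 * (1/2 - p) * z\<^sup>2 + 1 + q)
               + real n powr (-3/2) * z * (p * q) powr (1/2)
                 * (- 53/36 + (1/2 - p) / q + (z\<^sup>2 + 13/2) / (36 * p * q)
                    - 13 * z\<^sup>2 / 36))) \<le> 3 * K * norm (real n powr (-2))) sequentially"
    using eventually_gt_at_top[of 0]
  proof eventually_elim
    case (elim n)
    define e where "e = 1 / sqrt (real n)"
    define s where "s = sqrt (p * q)"
    have s: "0 < s" "s^2 = p * q" using p assms(5) by (auto simp: s_def)
    have e: "0 < e" "e^2 = 1 / real n" using elim by (auto simp: e_def power_divide)
    have e4: "e^4 = 1 / (real n)^2"
    proof -
      have "e^4 = (e^2)^2" by simp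
      thus ?thesis by (simp add: e power_divide)
    qed
    have e_powr: "real n powr (-1/2) = e" "real n powr (-3/2) = e^3" "real n powr (-2) = e^4"
    proof -
      have "real n powr (-(1/2)) = e" unfolding powr_minus e_def using elim by (simp add: powr_half_sqrt inverse_eq_divide)
      thus *: "real n powr (-1/2) = e" by simp
      have "real n powr (-3/2) = (real n powr (-1/2)) powr 3" by (simp add: powr_powr)
      thus "real n powr (-3/2) = e^3" unfolding * using e by (simp add: powr_numeral)
      show "real n powr (-2) = e^4" unfolding e4 using elim by (simp add: powr_minus powr_numeral inverse_eq_divide)
    qed
    have s_powr: "(p * q) powr (1/2) = s" using p assms(5) by (simp add: s_def powr_half_sqrt)
    have center: "1 / (3 * real n) * (2 * (1/2 - p) * z\<^sup>2 + 1 + q) = e^2 * cp_center z p"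
    proof -
      have "2 * (1/2 - p) * z\<^sup>2 + 1 + q = (1 - 2 * p) * z\<^sup>2 + 2 - p"
        by (simp add: assms(5) algebra_simps)
      moreover have "1 / (3 * real n) * A = e^2 * (A / 3)" for A by (simp add: e(2))
      ultimately show ?thesis by (simp only: cp_center_def)
    qed
    \<comment> \<open>z / (8 s) equals z s (9/2) / (36 p q), and 11 - 9/2 = 13/2; the term 18 p (1 -
      2 p) of \<open>cf2\<close> becomes (1/2 - p) / q.\<close>
    have third: "z * s * (- 53/36 + (1/2 - p) / q + (z\<^sup>2 + 13/2) / (36 * p * q) - 13 * z\<^sup>2 / 36)
        = cp_third z p - z / (8 * s)"
    proof -
      have pq: "p \<noteq> 0" "q \<noteq> 0" using p assms(5) by auto
      have "(1/2 - p) / q = 18 * p * (1 - 2 * p) / (36 * (p * q))" using pq by (simp add: field_simps)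
      moreover have "z / (8 * s) = z * s * ((9/2) / (36 * (p * q)))"
        using s(1) unfolding s(2)[symmetric] by (simp add: power2_eq_square)
      ultimately show ?thesis
        using pq
        by (simp add: cp_third_def cf2_def s_def[symmetric] assms(5)[symmetric]
            add_divide_distrib diff_divide_distrib algebra_simps)
    qed
    let ?E = "measure_pmf.expectation (binomial_pmf n p)"
    let ?d = "\<lambda>k. real k / real n - p"
    have "?E (\<lambda>k. cp_taylor e z p (?d k))
       = e * z * s + e^2 * cp_center z p + e^3 * (cp_third z p - z / (8 * s))"
      using expectation_cp_taylor[OF p elim(2), of z] by (simp add: e_def s_def assms(5))
    also have "\<dots> = real n powr (-1/2) * z * (p * q) powr (1/2)
               + 1 / (3 * real n) * (2 * (1/2 - p) * z\<^sup>2 + 1 + q)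
               + real n powr (-3/2) * z * (p * q) powr (1/2)
                 * (- 53/36 + (1/2 - p) / q + (z\<^sup>2 + 13/2) / (36 * p * q)
                    - 13 * z\<^sup>2 / 36)" (is "_ = ?main")
      unfolding center third[symmetric] e_powr s_powr by (simp only: mult.assoc)
    finally have "?E (cp_upper_length n \<alpha> p) - ?main = ?E (\<lambda>k. cp_upper_length n \<alpha> p k - cp_taylor e z p (?d k))"
      using p' by simp
    also have "\<bar>\<dots>\<bar> \<le> ?E (\<lambda>k. \<bar>cp_upper_length n \<alpha> p k - cp_taylor e z p (?d k)\<bar>)"
      by (rule integral_abs_bound)
    also have "\<dots> \<le> ?E (\<lambda>k. K * (e^4 + e^2 * (?d k)^2 + (?d k)^4))"
    proof (rule integral_mono_AE)
      show "AE k in measure_pmf (binomial_pmf n p). \<bar>cp_upper_length n \<alpha> p k - cp_taylor e z p (?d k)\<bar>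
          \<le> K * (e^4 + e^2 * (?d k)^2 + (?d k)^4)"
        using p R[OF elim(2,1)] by (auto simp: AE_measure_pmf_iff e_def)
    qed (use p' in auto)
    also have "\<dots> = K * (e^4 + e^2 * ?E (\<lambda>k. (?d k)^2) + ?E (\<lambda>k. (?d k)^4))"
      using p' by simp
    \<comment> \<open>Each of the three error terms has expectation at most e^4 = n^(-2), whence the
      constant 3 K.\<close>
    also have "\<dots> \<le> K * (e^4 + e^4 + e^4)"
    proof (intro mult_left_mono add_mono)
      have "p * (1 - p) \<le> 1 * 1" using p by (intro mult_mono) auto
      hence "e^2 * (p * (1 - p) / real n) \<le> e^2 * (1 / real n)"
        by (intro mult_left_mono divide_right_mono) auto
      also have "\<dots> = e^4" unfolding e(2)[symmetric] by (simp flip: power_add)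
      finally show "e^2 * ?E (\<lambda>k. (?d k)^2) \<le> e^4"
        unfolding binomial_proportion_moments(2)[OF p' elim(2)] .
      show "?E (\<lambda>k. (?d k)^4) \<le> e^4"
        using binomial_proportion_moments(3)[OF p' elim(2)] unfolding e4 .
    qed (use K in auto)
    finally show ?case unfolding e_powr(3) using e by simp
  qed
  thus ?thesis by (rule bigoI)
qed

end
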